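(* Let $\omega$ be a factor of the Fibonacci sequence $F_\infty$ with $\omega\notin\{\varepsilon,ab,ba,aba\}$, let $n=|\omega|$, let $k\ge0$ be the integer with $f_k\le n<f_{k+1}$, and let $\omega=\mu_1(\omega)\,sk(\omega)\,\mu_2(\omega)$ be its singular decomposition. (1) If $\omega\in\mathrm{T}1.1$, then $\nu_{\omega,1}=s_{k+1}$, $|\nu_{\omega,1}|=f_{k+1}>0$, and $\nu_{\omega,2}=s_{k-1}$, $|\nu_{\omega,2}|=f_{k-1}>0$. (2) If $\omega\in\mathrm{T}1.2$ with $\mu_1(\omega)=s_{k-2}[i-f_{k-1}+2,f_{k-2}]$ and $\mu_2(\omega)=s_{k-2}[1,i-f_{k-1}+1]$, where $f_{k-1}-1\le i\le f_k-1$, then $\nu_{\omega,1}=C_{i-f_{k-1}}(F_{k-1})$, $|\nu_{\omega,1}|=f_{k-1}>0$, and $\nu_{\omega,2}=\varepsilon$, $|\nu_{\omega,2}|=0$. (3) If $\omega\in\mathrm{T}1.3$ with $\mu_1(\omega)=s_{k-1}[i+2,f_{k-1}]$ and $\mu_2(\omega)=s_{k-1}[1,i+1]$, where $0\le i\le f_{k-1}-2$, then $\nu_{\omega,1}=\varepsilon$, $|\nu_{\omega,1}|=0$, and $\nu_{\omega,2}^{-1}=C_i(F_{k-2})$, $|\nu_{\omega,2}|=-f_{k-2}<0$. (4) If $\omega\in\mathrm{T}2.1$ with $\mu_1(\omega)=s_{k-1}[f_{k-1}-i+1,f_{k-1}]$ and $\mu_2(\omega)=s_{k-1}[1,n-f_k-i]$,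 where $0\le i\le n-f_k$, then $\nu_{\omega,1}=s_{k+1}[n-f_k-i+1,f_{k+1}-i]$, $|\nu_{\omega,1}|=f_{k+2}-n>0$, and $\nu_{\omega,2}=s_{k-1}[n-f_k-i+1,f_{k-1}-i]$, $|\nu_{\omega,2}|=f_{k+1}-n>0$. (5) If $\omega\in\mathrm{T}2.2$ with $\mu_1(\omega)=s_k[f_k-i+1,f_k]$ and $\mu_2(\omega)=s_k[1,n-f_{k-1}-i]$, where $0\le i\le n-f_{k-1}$, then $\nu_{\omega,1}=s_k[n-f_{k-1}-i+1,f_k-i]$, $|\nu_{\omega,1}|=f_{k+1}-n>0$, and $\nu_{\omega,2}^{-1}=F_{k+1}[f_k-i,n-i-1]$, $|\nu_{\omega,2}|=f_k-n<0$. (6) If $\omega\in\mathrm{T}2.3$ with $\mu_1(\omega)=s_{k-1}[f_{k+1}-n-i,f_{k-1}]$ and $\mu_2(\omega)=s_{k-1}[1,f_{k-1}-i-1]$, where $0\le i\le f_{k+1}-n-2$, then $\nu_{\omega,1}^{-1}=s_{k-1}[f_{k+1}-n-i,f_{k-1}-i-1]$, $|\nu_{\omega,1}|=f_k-n<0$, and $\nu_{\omega,2}^{-1}=F_k[f_{k+1}-n-i-1,f_k-i-2]$, $|\nu_{\omega,2}|=f_{k-1}-n<0$.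
   Context: Words are over $\{a,b\}$ and are regarded as elements of the free group on $a,b$; $\varepsilon$ is the empty word. $|\omega|$ is the length of a word, and for the inverse of a word $|\omega^{-1}|=-|\omega|$. Let $\sigma(a)=ab$, $\sigma(b)=a$, $F_k=\sigma^k(a)$ for $k\ge0$, and $F_\infty=x_1x_2\cdots=\lim_{k\to\infty}F_k$ (Fibonacci sequence). Let $f_{-1}=f_0=1$, $f_{k+1}=f_k+f_{k-1}$, so $|F_k|=f_k$. For $k\ge0$ let $\alpha$ be the last letter of $F_k$ and $\beta$ the other letter. The singular words are $s_{-1}=a$ and $s_k=\beta F_k\alpha^{-1}$ for $k\ge0$ (delete the last letter of $F_k$ and prepend $\beta$); $|s_k|=f_k$. For a word $\tau=y_1y_2\cdots$, $\tau[i,j]=y_i\cdots y_j$ and $\tau[i,i-1]=\varepsilon$. For a word $\tau=y_1\cdots y_m$ and $0\le i\le m-1$, $C_i(\tau)=y_{i+1}\cdots y_my_1\cdots y_i$; for any other integer $j$, $C_j(\tau)=C_i(\tau)$ where $0\le i\le m-1$, $i\equiv j \pmod m$. Only for evaluating formulas when $k=0$, put $f_{-2}=0$, $s_{-2}=\varepsilon$ (not counted as a singular word) and $F_{-1}=b$. The singular kernel $sk(\omega)$ is the longest singular word that is a factor of $\omega$; for a factor $\omega\notin\{\varepsilon,ab,ba,aba\}$ of $F_\infty$ it is well defined and occurs exactly once in $\omega$, so $\omega=\mu_1(\omega)\,sk(\omega)\,\mu_2(\omega)$ for uniquely determined words $\mu_1(\omega),\mu_2(\omega)$ (the singular decomposition).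 Types: for a factor $\omega\notin\{\varepsilon,ab,ba,aba\}$ of $F_\infty$ let $k\ge0$ be the unique integer with $f_k\le|\omega|<f_{k+1}$. Then $\omega\in\mathrm{T}1.j$ iff $|\omega|=f_k$ and $sk(\omega)=s_{k-j+1}$, and $\omega\in\mathrm{T}2.j$ iff $f_k<|\omega|<f_{k+1}$ and $sk(\omega)=s_{k-j+1}$, for $j=1,2,3$ (for $j=3$ only $k\ge1$ is considered). Gaps: $\omega_p$ denotes the $p$-th occurrence of $\omega$ in $F_\infty$ ($p\ge1$). If $\omega_p=x_{i+1}\cdots x_{i+n}$ and $\omega_{p+1}=x_{j+1}\cdots x_{j+n}$ (as positioned blocks), the gap $\nu_{\omega,p}$ is $\varepsilon$ if $i+n=j$; it is $x_{i+n+1}\cdots x_j$ if $i+n<j$; and it is $(x_{j+1}\cdots x_{i+n})^{-1}$ if $i+n>j$. *)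

theory Defs
  imports "HOL-Library.Sublist" "HOL-Library.Infinite_Set" "HOL-Number_Theory.Fib"
begin

datatype letter = La | Lb

type_synonym word = "letter list"

fun other :: "letter \<Rightarrow> letter" where
  "other La = Lb"
| "other Lb = La"

text \<open>
  Elements of the free group are represented by their reduced words: lists of signed letters,
  where \<^term>\<open>(x, True)\<close> stands for the letter \<^term>\<open>x\<close> and \<^term>\<open>(x, False)\<close> for its inverse.
\<close>

definition reduced :: "(letter \<times> bool) list \<Rightarrow> bool" where
  "reduced u \<longleftrightarrow> successively (\<lambda>x y. \<not> (fst x = fst y \<and> snd x \<noteq> snd y)) u"

typedef free_group = "{u. reduced u}"
  morphisms signed_letters Free_group
  by (rule exI[of _ "[]"]) (simp add: reduced_def)

setup_lifting type_definition_free_group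

lift_definition of_word :: "word \<Rightarrow> free_group" is "map (\<lambda>x. (x, True))"
  by (simp add: reduced_def successively_map successively_conv_nth)

lift_definition finv :: "free_group \<Rightarrow> free_group" is "\<lambda>u. rev (map (\<lambda>(x, e). (x, \<not> e)) u)"
  by (simp add: reduced_def successively_map split_beta) (auto elim!: successively_mono)

text \<open>
  The exponent sum: it is the length on words, and minus the length on inverses of words.
\<close>

lift_definition flen :: "free_group \<Rightarrow> int" is
  "\<lambda>u. sum_list (map (\<lambda>(x, e). if e then 1 else - 1) u)" .

lemma of_word_inject: "of_word u = of_word v \<longleftrightarrow> u = v"
  by transfer (simp add: inj_map_eq_map inj_def)

lemma finv_finv: "finv (finv g) = g"
  by transfer (simp add: rev_map comp_def split_beta)

lemma flen_of_word: "flen (of_word w) = int (length w)"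
  by transfer (simp add: comp_def sum_list_triv)

lemma flen_finv: "flen (finv g) = - flen g"
proof transfer
  fix u :: "(letter \<times> bool) list"
  show "sum_list (map (\<lambda>(x, e). if e then 1 else - 1) (rev (map (\<lambda>(x, e). (x, \<not> e)) u))) =
        - sum_list (map (\<lambda>(x, e). if e then 1 else - 1 :: int) u)"
    by (induction u) auto
qed

fun \<sigma> :: "letter \<Rightarrow> word" where
  "\<sigma> La = [La, Lb]"
| "\<sigma> Lb = [La]"

definition morph :: "word \<Rightarrow> word" where
  "morph w = concat (map \<sigma> w)"

text \<open>
  The indices of $f_k$, $F_k$ and $s_k$ are integers, meaningful for $k \ge -2$, $k \ge -1$ and
  $k \ge -2$ respectively; below that range the values are junk.  The library function
  \<^const>\<open>fib\<close> starts with 0, 1, 1, 2, so that the convention $f_{-2} = 0$, $f_{-1} = f_0 = 1$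
  is a shift by two.
\<close>

definition fibl :: "int \<Rightarrow> int" where
  "fibl k = int (fib (nat (k + 2)))"

definition Fw :: "int \<Rightarrow> word" where
  "Fw k = (if k \<ge> 0 then (morph ^^ nat k) [La] else if k = - 1 then [Lb] else [])"

definition sing :: "int \<Rightarrow> word" where
  "sing k = (if k \<ge> 0 then other (last (Fw k)) # butlast (Fw k) else if k = - 1 then [La] else [])"

text \<open>
  The letters $x_1, x_2, \ldots$ of the limit word are indexed from 1; \<open>fibx 0\<close> is junk.
\<close>

definition fibx :: "nat \<Rightarrow> letter" where
  "fibx m = (THE c. \<forall>\<^sub>F k in sequentially. m \<le> length (Fw (int k)) \<and> Fw (int k) ! (m - 1) = c)"

text \<open>\<open>block i j\<close> is $x_{i+1} \cdots x_j$.\<close>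

definition block :: "nat \<Rightarrow> nat \<Rightarrow> word" where
  "block i j = map fibx [Suc i..<Suc j]"

definition occurs_at :: "word \<Rightarrow> nat \<Rightarrow> bool" where
  "occurs_at w i \<longleftrightarrow> block i (i + length w) = w"

definition is_factor :: "word \<Rightarrow> bool" where
  "is_factor w \<longleftrightarrow> (\<exists>i. occurs_at w i)"

text \<open>\<open>sub t i j\<close> is $t[i,j] = y_i \cdots y_j$, with indices starting from 1.\<close>

definition sub :: "word \<Rightarrow> int \<Rightarrow> int \<Rightarrow> word" where
  "sub t i j = take (nat (j - i + 1)) (drop (nat (i - 1)) t)"

definition cyc :: "int \<Rightarrow> word \<Rightarrow> word" where
  "cyc j t = rotate (nat (j mod int (length t))) t"

definition is_singular :: "word \<Rightarrow> bool" where
  "is_singular w \<longleftrightarrow> (\<exists>k \<ge> - 1. w = sing k)"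

text \<open>
  Two singular words have length 1, so the longest one is unique only outside of the exceptional
  factors $\varepsilon, ab, ba, aba$; there \<open>sk\<close> is junk.
\<close>

definition sk :: "word \<Rightarrow> word" where
  "sk w = (THE v. is_singular v \<and> sublist v w \<and>
                  (\<forall>v'. is_singular v' \<and> sublist v' w \<longrightarrow> length v' \<le> length v))"

definition sing_decomp :: "word \<Rightarrow> word \<times> word" where
  "sing_decomp w = (THE (u, v). w = u @ sk w @ v)"

definition \<mu>1 :: "word \<Rightarrow> word" where
  "\<mu>1 w = fst (sing_decomp w)"

definition \<mu>2 :: "word \<Rightarrow> word" where
  "\<mu>2 w = snd (sing_decomp w)"

definition regular_factor :: "word \<Rightarrow> bool" where
  "regular_factor w \<longleftrightarrow> is_factor w \<and> w \<notin> {[], [La, Lb], [Lb, La], [La, Lb, La]}"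

text \<open>
  In \<open>T1\<close> the equation $|w| = f_k$ with $k \ge 0$ determines $k$ and implies $|w| < f_{k+1}$.
\<close>

definition T1 :: "nat \<Rightarrow> word \<Rightarrow> bool" where
  "T1 j w \<longleftrightarrow> regular_factor w \<and> j \<in> {1, 2, 3} \<and>
     (\<exists>k \<ge> 0. (j = 3 \<longrightarrow> k \<ge> 1) \<and> int (length w) = fibl k \<and> sk w = sing (k - int j + 1))"

definition T2 :: "nat \<Rightarrow> word \<Rightarrow> bool" where
  "T2 j w \<longleftrightarrow> regular_factor w \<and> j \<in> {1, 2, 3} \<and>
     (\<exists>k \<ge> 0. (j = 3 \<longrightarrow> k \<ge> 1) \<and> fibl k < int (length w) \<and> int (length w) < fibl (k + 1) \<and>
        sk w = sing (k - int j + 1))"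

text \<open>
  \<open>offset w p\<close> is the number of letters preceding the \<open>p\<close>-th occurrence of \<open>w\<close>, for $p \ge 1$
  (\<^const>\<open>enumerate\<close> counts from 0).
\<close>

definition offset :: "word \<Rightarrow> nat \<Rightarrow> nat" where
  "offset w p = enumerate {i. occurs_at w i} (p - 1)"

definition gap :: "word \<Rightarrow> nat \<Rightarrow> free_group" where
  "gap w p =
     (let n = length w; i = offset w p; j = offset w (p + 1) in
      if i + n = j then of_word []
      else if i + n < j then of_word (block (i + n) j)
      else finv (of_word (block j (i + n))))"

end

theory Submission
  imports Defs
begin

text \<open>
  The Fibonacci sequence is fixed by $\sigma$, and $\sigma$ can be undone: every $a$ in it starts an
  image $\sigma(x_i)$, because a $b$ occurs only inside $\sigma(a) = ab$.  So the occurrences of a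
  word $\sigma(u)a$ are exactly the images of those of $u$ (\<open>desubstitution\<close>).  Start
  with the letter $a$ and iterate $u \mapsto \sigma(u)a$.  The words obtained are the prefixes of
  length $f_{K+2} - 2$ (\<open>central\<close>), and the occurrences of $a$ with offsets 0, 2, 3 become
  occurrences with offsets 0, $f_{K+1}$, $f_{K+2}$; these are the first three
  (\<open>central_first_three\<close>).

  The singular word $s_{K-1}$ sits in the middle of the $K$-th central word, with $f_K - 1$ letters on
  either side, and, again by desubstitution, it occurs nowhere else (\<open>occurs_sing\<close>).  Its
  surroundings are therefore the same at each of its occurrences, up to $f_K - 1$ letters to the
  left and to the right.  If $\omega = \mu_1 s_{K-1} \mu_2$ is a factor with $\mu_1$, $\mu_2$ shorter
  than $f_K$, every occurrence of $s_{K-1}$ extends to one of $\omega$, whatever the letters of $\mu_1$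
  and $\mu_2$ are; this gives the first three offsets of $\omega$ as
  $f_K - 1 - |\mu_1|$ plus 0, $f_{K+1}$, $f_{K+2}$ (\<open>offsets_around_sing\<close>).
  All six types satisfy the length condition.

  It remains to recognise the gaps, which are now blocks of the sequence between known positions.
  The words on the other side of the equations are blocks as well: $F_j$ is a prefix, $s_j$ has
  known occurrences, and the conjugates of $F_j$ are read off a prefix with period $f_j$.
  Two such blocks are compared by means of the occurrences of the central words at all
  sufficiently large $f_j$ (\<open>block_fib_add\<close>).

  The kernel and its decomposition, finally, are well defined because between two occurrences of a
  singular word there is always one of a larger index (\<open>between_sing_occurrences\<close>),
  which follows by desubstitution from the same assertion about two letters $a$.

  Throughout, $f_j$ is the library's Fibonacci number of index $j+2$, and a singular word is written
  as $s_{K-1}$ with a natural number $K$, so that inductions start at $s_{-1} = a$.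
\<close>

section \<open>Fibonacci numbers\<close>

text \<open>
  The recursion would unfold every $f_j$ in sight; it is applied by hand, usually to write all the
  Fibonacci numbers of a goal as combinations of two consecutive ones, which leaves linear
  arithmetic.
\<close>

declare fib.simps(3) [simp del]

lemma fib_small: "fib 2 = 1" "fib 3 = 2" "fib 4 = 3"
  by (simp_all add: fib.simps(3) eval_nat_numeral)

lemma fib_2_3 [simp]: "fib (Suc (Suc 0)) = 1" "fib (Suc (Suc (Suc 0))) = 2"
  by (simp_all add: fib.simps(3))

lemma fib_pos: "fib (Suc n) > 0"
  by (rule fib_neq_0_nat) simp

lemma le_fib: "n \<le> fib (n + 2)"
proof (induction n)
  case (Suc n)
  have "fib (Suc n) > 0" by (rule fib_neq_0_nat) simp
  then show ?case using Suc by (simp add: fib.simps(3))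
qed simp

lemma fib_less_Suc: "n \<ge> 2 \<Longrightarrow> fib n < fib (Suc n)"
proof (cases n rule: fib.cases)
  case (3 m)
  then show ?thesis using fib_neq_0_nat[of "Suc m"] by (simp add: fib.simps(3))
qed auto

text \<open>
  The exception is the pair $s_{-1} = a$, $s_0 = b$ of distinct singular words of equal length.
\<close>

lemma fib_Suc_less: "K < K' \<Longrightarrow> fib (K + 1) < fib (K' + 1) \<or> (K = 0 \<and> K' = 1)"
proof -
  assume K: "K < K'"
  show ?thesis
  proof (cases "K = 0")
    case True
    have "fib 3 \<le> fib (K' + 1)" if "K' \<noteq> 1" using that K True by (intro fib_mono) simp
    then show ?thesis using True by (auto simp: fib_small)
  next
    case False
    have "fib (K + 1) < fib (Suc (K + 1))" using False by (intro fib_less_Suc) simp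
    also have "\<dots> \<le> fib (K' + 1)" using K by (intro fib_mono) simp
    finally show ?thesis by blast
  qed
qed

lemma fib_ge3: "fib (K + 4) \<ge> 3"
proof -
  have "fib 4 \<le> fib (K + 4)" by (rule fib_mono) simp
  then show ?thesis by (simp add: fib_small)
qed

text \<open>
  The palindromic prefix of length $f_{K+2} - 2$ is a singular word of length $f_{K-1}$ with
  $f_K - 1$ letters on either side.
\<close>

lemma fib_central: "2 * fib (K + 2) + fib (K + 1) = fib (K + 4)"
  by (simp add: fib.simps(3) eval_nat_numeral)

lemma fib_sums:
  "fib (m + 2) = fib m + fib (m + 1)" "fib (m + 3) = fib m + 2 * fib (m + 1)"
  "fib (m + 4) = 2 * fib m + 3 * fib (m + 1)" "fib (m + 5) = 3 * fib m + 5 * fib (m + 1)"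
  by (simp_all add: fib.simps(3) eval_nat_numeral)

section \<open>The Fibonacci words\<close>

text \<open>Counting the letters from 0 makes an offset the index of the first letter after it.\<close>

abbreviation ltr :: "nat \<Rightarrow> letter" where
  "ltr i \<equiv> fibx (Suc i)"

lemma morph_simps [simp]:
  "morph [] = []" "morph (c # w) = \<sigma> c @ morph w" "morph (u @ v) = morph u @ morph v"
  by (simp_all add: morph_def)

lemma Fw_0: "Fw 0 = [La]"
  by (simp add: Fw_def)

lemma Fw_Suc: "Fw (int (Suc k)) = morph (Fw (int k))"
  by (simp add: Fw_def nat_add_distrib)

lemma Fw_rec: "Fw (int (Suc (Suc k))) = Fw (int (Suc k)) @ Fw (int k)"
proof (induction k)
  case 0
  have "Fw (int (Suc 0)) = [La, Lb]" by (subst Fw_Suc) (simp add: Fw_0)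
  moreover have "Fw (int (Suc (Suc 0))) = [La, Lb, La]"
    by (subst Fw_Suc, subst Fw_Suc) (simp add: Fw_0)
  ultimately show ?case by (simp add: Fw_0)
next
  case (Suc k)
  then show ?case by (metis Fw_Suc morph_simps(3))
qed

lemma length_Fw: "length (Fw (int k)) = fib (k + 2)"
proof (induction k rule: fib.induct)
  case 1
  then show ?case by (simp add: Fw_0)
next
  case 2
  have "Fw (int (Suc 0)) = [La, Lb]" by (subst Fw_Suc) (simp add: Fw_0)
  then show ?case by (simp add: fib.simps(3))
next
  case (3 n)
  have "length (Fw (int (Suc (Suc n)))) = length (Fw (int (Suc n))) + length (Fw (int n))"
    by (simp only: Fw_rec length_append)
  then show ?case using 3 by (simp add: fib.simps(3))
qed

lemma Fw_prefix_Suc: "prefix (Fw (int k)) (Fw (int (Suc k)))"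
proof (cases k)
  case 0
  have "Fw (int (Suc 0)) = [La, Lb]" by (subst Fw_Suc) (simp add: Fw_0)
  then show ?thesis using 0 by (simp add: Fw_0)
next
  case (Suc j)
  then show ?thesis using Fw_rec[of j] by (metis prefixI)
qed

lemma Fw_prefix: "j \<le> k \<Longrightarrow> prefix (Fw (int j)) (Fw (int k))"
  by (induction k rule: dec_induct) (blast, metis Fw_prefix_Suc prefix_order.trans)

lemma Fw_nth_mono: "\<lbrakk>i < length (Fw (int j)); j \<le> k\<rbrakk> \<Longrightarrow> Fw (int k) ! i = Fw (int j) ! i"
  using Fw_prefix[of j k] by (auto simp: prefix_def nth_append)

lemma fibx_nth:
  assumes "i < length (Fw (int k))"
  shows "ltr i = Fw (int k) ! i"
proof -
  define Q where "Q c j \<longleftrightarrow> Suc i \<le> length (Fw (int j)) \<and> Fw (int j) ! (Suc i - 1) = c" for c j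
  have Q: "Q (Fw (int k) ! i) j" if "k \<le> j" for j
    unfolding Q_def using Fw_nth_mono[OF assms that] prefix_length_le[OF Fw_prefix[OF that]] assms
    by simp
  have "(THE c. eventually (Q c) sequentially) = Fw (int k) ! i"
  proof (rule the_equality)
    show "eventually (Q (Fw (int k) ! i)) sequentially"
      using Q by (rule eventually_sequentiallyI)
    fix c
    assume "eventually (Q c) sequentially"
    then obtain N where "\<forall>j\<ge>N. Q c j" unfolding eventually_sequentially by (rule exE)
    then have "Q c (max N k)" by simp
    then show "c = Fw (int k) ! i" using Q[of "max N k"] by (simp add: Q_def)
  qed
  then show ?thesis unfolding fibx_def Q_def .
qed

lemma length_block [simp]: "length (block i j) = j - i"
  by (simp add: block_def del: upt_Suc)

lemma nth_block [simp]: "r < j - i \<Longrightarrow> block i j ! r = ltr (i + r)"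
  by (simp add: block_def del: upt_Suc)

lemma block_empty [simp]: "j \<le> i \<Longrightarrow> block i j = []"
  by (simp add: block_def)

lemma block_append: "\<lbrakk>i \<le> j; j \<le> k\<rbrakk> \<Longrightarrow> block i j @ block j k = block i k"
  by (rule nth_equalityI) (auto simp: nth_append add.commute)

lemma block_Suc: "i \<le> j \<Longrightarrow> block i (Suc j) = block i j @ [ltr j]"
  by (simp add: block_def)

lemma block_Fw: "block 0 (fib (k + 2)) = Fw (int k)"
  by (rule nth_equalityI) (auto simp: length_Fw fibx_nth[of _ k])

lemma occurs_at_nth: "occurs_at w i \<longleftrightarrow> (\<forall>r < length w. ltr (i + r) = w ! r)"
  unfolding occurs_at_def list_eq_iff_nth_eq by simp

lemma occurs_at_append: "occurs_at (u @ v) i \<longleftrightarrow> occurs_at u i \<and> occurs_at v (i + length u)"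
proof
  assume *: "occurs_at (u @ v) i"
  have "ltr (i + r) = u ! r" if "r < length u" for r
    using *[unfolded occurs_at_nth, rule_format, of r] that by (simp add: nth_append)
  moreover have "ltr (i + length u + r) = v ! r" if "r < length v" for r
    using *[unfolded occurs_at_nth, rule_format, of "length u + r"] that
    by (simp add: nth_append add.assoc)
  ultimately show "occurs_at u i \<and> occurs_at v (i + length u)" by (simp add: occurs_at_nth)
next
  assume *: "occurs_at u i \<and> occurs_at v (i + length u)"
  show "occurs_at (u @ v) i" unfolding occurs_at_nth
  proof (intro allI impI)
    fix r assume r: "r < length (u @ v)"
    show "ltr (i + r) = (u @ v) ! r"
    proof (cases "r < length u")
      case False
      then obtain t where "r = length u + t" using le_Suc_ex not_le by blast
      then show ?thesis using * r by (simp add: occurs_at_nth add.assoc)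
    qed (use * in \<open>simp add: occurs_at_nth nth_append\<close>)
  qed
qed

lemma occurs_at_Nil [simp]: "occurs_at [] i"
  by (simp add: occurs_at_nth)

lemma occurs_at_Cons [simp]: "occurs_at (c # w) i \<longleftrightarrow> ltr i = c \<and> occurs_at w (Suc i)"
proof -
  have "occurs_at [c] i \<longleftrightarrow> ltr i = c" by (simp add: occurs_at_nth)
  then show ?thesis using occurs_at_append[of "[c]" w i] by simp
qed

lemma occurs_at_block [simp]: "occurs_at (block i j) i"
  by (simp add: occurs_at_nth)

lemma occurs_at_blockD: "occurs_at w i \<Longrightarrow> w = block i (i + length w)"
  unfolding occurs_at_def by (rule sym)

lemma occurs_at_0I: "prefix w (Fw (int k)) \<Longrightarrow> occurs_at w 0"
  using occurs_at_block[of 0 "fib (k + 2)"]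
  by (auto simp: block_Fw prefix_def occurs_at_append simp del: add_2_eq_Suc')

section \<open>Desubstitution\<close>

text \<open>
  The sequence is its own image under $\sigma$, and \<open>pos i\<close> is the offset at which the image of
  the letter with index \<open>i\<close> begins.
\<close>

definition pos :: "nat \<Rightarrow> nat" where
  "pos i = length (morph (block 0 i))"

lemma pos_0 [simp]: "pos 0 = 0"
  by (simp add: pos_def)

lemma pos_Suc: "pos (Suc i) = pos i + length (\<sigma> (ltr i))"
  by (simp add: pos_def block_Suc)

lemma strict_mono_pos: "strict_mono pos"
proof -
  have "pos n < pos (Suc n)" for n by (cases "ltr n") (simp_all add: pos_Suc)
  then show ?thesis by (simp add: strict_mono_Suc_iff)
qed

lemma occurs_at_morph_prefix: "occurs_at (morph (block 0 i)) 0"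
proof -
  have "prefix (block 0 i) (Fw (int i))"
    unfolding block_Fw[symmetric] using le_fib[of i] by (metis block_append le0 prefixI)
  then obtain v where "Fw (int i) = block 0 i @ v" by (auto simp: prefix_def)
  then have "Fw (int (Suc i)) = morph (block 0 i) @ morph v" by (simp only: Fw_Suc morph_simps)
  then show ?thesis by (metis occurs_at_0I prefixI)
qed

lemma occurs_at_sigma: "occurs_at (\<sigma> (ltr i)) (pos i)"
  using occurs_at_morph_prefix[of "Suc i"] by (simp add: block_Suc occurs_at_append pos_def)

lemma ltr_pos: "ltr (pos i) = La"
  using occurs_at_sigma[of i] by (cases "ltr i") auto

lemma pos_cases:
  obtains "ltr i = La" "ltr (Suc (pos i)) = Lb" "pos (Suc i) = pos i + 2"
  | "ltr i = Lb" "ltr (Suc (pos i)) = La" "pos (Suc i) = pos i + 1"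
proof (cases "ltr i")
  case La
  then show ?thesis using that(1) occurs_at_sigma[of i] by (simp add: pos_Suc)
next
  case Lb
  then show ?thesis using that(2) ltr_pos[of "Suc i"] by (simp add: pos_Suc)
qed

lemma pos_interval:
  obtains i where "pos i \<le> q" "q < pos (Suc i)"
proof -
  have "\<exists>i. pos i \<le> q \<and> q < pos (Suc i)"
  proof (induction q)
    case 0
    show ?case using strict_mono_pos by (metis le0 lessI pos_0 strict_mono_less)
  next
    case (Suc q)
    then obtain i where i: "pos i \<le> q" "q < pos (Suc i)" by blast
    have "pos (Suc i) < pos (Suc (Suc i))" using strict_mono_pos by (simp add: strict_mono_less)
    then show ?case using i by (metis Suc_leI le_SucI le_neq_implies_less order.refl)
  qed
  then show ?thesis using that by blast
qed

text \<open>
  The second letter of an image is never $a$.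
\<close>

lemma ltr_La_pos:
  assumes "ltr q = La"
  obtains i where "q = pos i"
proof -
  obtain i where i: "pos i \<le> q" "q < pos (Suc i)" by (rule pos_interval)
  show ?thesis
  proof (cases i rule: pos_cases)
    case 1
    then have "q = pos i \<or> q = Suc (pos i)" using i by auto
    then show ?thesis using 1 assms that by auto
  next
    case 2
    then have "q = pos i" using i by simp
    then show ?thesis by (rule that)
  qed
qed

lemma ltr_0: "ltr 0 = La"
  using ltr_pos[of 0] by simp

lemma ltr_Lb_neighbours:
  assumes "ltr q = Lb"
  shows "q > 0" and "ltr (q - 1) = La" and "ltr (Suc q) = La"
proof -
  obtain i where i: "pos i \<le> q" "q < pos (Suc i)" by (rule pos_interval)
  have "q \<noteq> pos i" using assms ltr_pos by auto
  then have "q = Suc (pos i) \<and> pos (Suc i) = Suc q"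
    using i by (cases i rule: pos_cases) auto
  then show "q > 0" "ltr (q - 1) = La" "ltr (Suc q) = La"
    using ltr_pos by (metis zero_less_Suc, metis diff_Suc_1, metis)
qed

text \<open>
  The final $a$ decides whether a last letter $a$ of $\sigma(u)$ is a whole image or the first half of
  $\sigma(a) = ab$.  Each $a$ starts an image, and the image is $ab$ or $a$ according to whether
  $b$ or $a$ follows; so $u$ can be read off $\sigma(u)a$ from the left.
\<close>

lemma desubstitution:
  "occurs_at (morph u @ [La]) q \<longleftrightarrow> (\<exists>i. q = pos i \<and> occurs_at u i)"
proof
  show "\<exists>i. q = pos i \<and> occurs_at u i" if "occurs_at (morph u @ [La]) q"
    using that
  proof (induction u arbitrary: q)
    case Nil
    then show ?case by (auto elim: ltr_La_pos)
  next
    case (Cons c u)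
    have "ltr q = La" using Cons.prems by (cases c) auto
    then obtain i where i: "q = pos i" by (rule ltr_La_pos)
    have "occurs_at (morph u @ [La]) (q + length (\<sigma> c))"
      using Cons.prems by (simp add: occurs_at_append add.assoc)
    then obtain j where j: "q + length (\<sigma> c) = pos j" "occurs_at u j"
      using Cons.IH by blast
    have "ltr i = c"
    proof (cases c)
      case La
      then have "ltr (Suc q) = Lb" using Cons.prems by simp
      then show ?thesis using i La by (cases i rule: pos_cases) auto
    next
      case Lb
      then have "ltr (Suc q) = La" using j ltr_pos[of j] by simp
      then show ?thesis using i Lb by (cases i rule: pos_cases) auto
    qed
    then have "j = Suc i"
      using j i strict_mono_pos by (metis pos_Suc strict_mono_eq)
    then show ?case using i j \<open>ltr i = c\<close> by auto
  qed
next
  have "occurs_at (morph u) (pos i) \<and> pos (i + length u) = pos i + length (morph u)"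
    if "occurs_at u i" for i
    using that
  proof (induction u arbitrary: i)
    case (Cons c u)
    then show ?case
      using occurs_at_sigma[of i] Cons.IH[of "Suc i"] by (auto simp: occurs_at_append pos_Suc)
  qed auto
  then show "occurs_at (morph u @ [La]) q" if "\<exists>i. q = pos i \<and> occurs_at u i"
    using that by (auto simp: occurs_at_append) (metis ltr_pos)
qed

text \<open>shift\<close>
text \<open>
  Where a prefix recurs, the images of its letters have the same lengths as at the beginning.
\<close>

lemma pos_add_of_occurs:
  assumes "occurs_at (block 0 L) t" "r \<le> L"
  shows "pos (t + r) = pos t + pos r"
  using assms(2)
proof (induction r)
  case (Suc r)
  then have "ltr (t + r) = ltr r" using assms(1) by (simp add: occurs_at_nth)
  then show ?case using Suc by (simp add: pos_Suc)
qed simp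

lemma pos_fib: "pos (fib (k + 2)) = fib (k + 3)"
proof -
  have "pos (fib (k + 2)) = length (Fw (int (Suc k)))"
    by (simp only: Fw_Suc pos_def block_Fw)
  then show ?thesis by (simp only: length_Fw) (simp add: numeral_3_eq_3)
qed

lemma Fw_ends:
  "\<exists>u. Fw (int (Suc k)) = u @ (if even k then [La, Lb] else [Lb, La])"
proof (induction k)
  case 0
  have "Fw (int (Suc 0)) = [La, Lb]" by (subst Fw_Suc) (simp add: Fw_0)
  then show ?case by auto
next
  case (Suc k)
  then obtain u where u: "Fw (int (Suc k)) = u @ (if even k then [La, Lb] else [Lb, La])" by blast
  have "Fw (int (Suc (Suc k))) = (morph u @ [La]) @ (if even (Suc k) then [La, Lb] else [Lb, La])"
    unfolding Fw_Suc[of "Suc k"] u by simp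
  then show ?case by blast
qed

text \<open>
  These are the nonempty palindromic prefixes of the sequence.  They are $F_{K+2}$ without its last
  two letters, the only ones in which $F_{K+1}F_K$ and $F_K F_{K+1}$ differ.
\<close>

definition central :: "nat \<Rightarrow> word" where
  "central K = block 0 (fib (K + 4) - 2)"

text \<open>
  The two letters of $F_{K+2}$ that are left out are $ab$ or $ba$, with an image of length 3, of
  which the final $a$ of the next central word restores one letter.
\<close>

lemma pos_central: "Suc (pos (fib (K + 4) - 2)) = fib (K + 5) - 2"
proof -
  define N where "N = fib (K + 4) - 2"
  have N: "fib (K + 4) = Suc (Suc N)" using fib_ge3[of K] by (simp add: N_def)
  obtain u where u: "Fw (int (Suc (Suc K))) = u @ (if even (Suc K) then [La, Lb] else [Lb, La])"
    using Fw_ends by blast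
  have len: "length (Fw (int (Suc (Suc K)))) = Suc (Suc N)"
    using length_Fw[of "Suc (Suc K)"] N by (simp add: eval_nat_numeral)
  then have "length u = N" unfolding u by (cases "even K") simp_all
  then have "{ltr N, ltr (Suc N)} = {La, Lb}"
    using fibx_nth[of N "Suc (Suc K)"] fibx_nth[of "Suc N" "Suc (Suc K)"] len u
    by (auto simp: nth_append simp del: of_nat_Suc)
  then have "pos (Suc (Suc N)) = pos N + 3"
    by (auto simp: pos_Suc doubleton_eq_iff)
  moreover have "pos (Suc (Suc N)) = fib (K + 5)"
    using pos_fib[of "Suc (Suc K)"] N by (simp add: eval_nat_numeral)
  ultimately show ?thesis by (simp add: N_def)
qed

lemma central_0: "central 0 = [La]"
  by (simp add: central_def fib_small block_Suc ltr_0)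

lemma central_Suc: "central (Suc K) = morph (central K) @ [La]"
proof -
  have "occurs_at (morph (central K) @ [La]) 0"
    unfolding desubstitution by (rule exI[of _ 0]) (simp add: central_def)
  then have "morph (central K) @ [La] = block 0 (Suc (pos (fib (K + 4) - 2)))"
    by (metis (no_types) add_0 central_def length_append_singleton occurs_at_blockD pos_def)
  then show ?thesis unfolding pos_central by (simp add: central_def add.commute)
qed

lemma occurs_central_Suc:
  "occurs_at (central (Suc K)) q \<longleftrightarrow> (\<exists>i. q = pos i \<and> occurs_at (central K) i)"
  by (simp add: central_Suc desubstitution)

text \<open>
  The occurrences of $a$ begin with 0, 2, 3, and \<open>pos\<close> is increasing and takes $f_j$ to $f_{j+1}$.
\<close>

lemma central_first_three:
  "occurs_at (central K) 0 \<and> occurs_at (central K) (fib (K + 3)) \<and> occurs_at (central K) (fib (K + 4)) \<and>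
   (\<forall>q \<le> fib (K + 4). occurs_at (central K) q \<longrightarrow> q \<in> {0, fib (K + 3), fib (K + 4)})"
proof (induction K)
  case 0
  have "Fw (int 3) = [La, Lb, La, La, Lb]"
    using Fw_Suc[of 0] Fw_Suc[of 1] Fw_Suc[of 2] by (simp add: Fw_0 numeral_2_eq_2 numeral_3_eq_3)
  then have "ltr 0 = La" "ltr (Suc 0) = Lb" "ltr 2 = La" "ltr 3 = La"
    using fibx_nth[of 0 3] fibx_nth[of 1 3] fibx_nth[of 2 3] fibx_nth[of 3 3] by simp_all
  then show ?case by (auto simp: fib_small central_0 le_Suc_eq numeral_2_eq_2 numeral_3_eq_3)
next
  case (Suc K)
  have p: "pos (fib (K + 3)) = fib (Suc K + 3)" "pos (fib (K + 4)) = fib (Suc K + 4)"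
    using pos_fib[of "Suc K"] pos_fib[of "Suc (Suc K)"] by (simp_all add: eval_nat_numeral)
  have "occurs_at (central (Suc K)) 0" 
    unfolding occurs_central_Suc using Suc by (intro exI[of _ 0]) simp
  moreover have "occurs_at (central (Suc K)) (fib (Suc K + 3))"
      "occurs_at (central (Suc K)) (fib (Suc K + 4))"
    unfolding occurs_central_Suc using Suc p by metis+
  moreover have "q \<in> {0, fib (Suc K + 3), fib (Suc K + 4)}"
    if q: "q \<le> fib (Suc K + 4)" "occurs_at (central (Suc K)) q" for q
  proof -
    obtain i where i: "q = pos i" "occurs_at (central K) i"
      using q(2) occurs_central_Suc by blast
    then have "i \<le> fib (K + 4)"
      using q(1) p(2) strict_mono_pos by (metis strict_mono_less_eq)
    then have "i \<in> {0, fib (K + 3), fib (K + 4)}" using Suc i by blast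
    then show ?thesis using i p by auto
  qed
  ultimately show ?case by blast
qed

section \<open>Occurrences of singular words\<close>

lemma Fw_last: "Fw (int k) = butlast (Fw (int k)) @ [if even k then La else Lb]"
proof (cases k)
  case (Suc j)
  then show ?thesis using Fw_ends[of j] by (auto simp: butlast_append split: if_splits)
qed (simp add: Fw_0)

lemma sing_minus_1: "sing (- 1) = [La]"
  by (simp add: sing_def)

lemma sing_Fw: "sing (int k) = (if even k then Lb else La) # butlast (Fw (int k))"
proof -
  have "last (Fw (int k)) = (if even k then La else Lb)"
    by (subst Fw_last) simp
  then show ?thesis by (simp add: sing_def)
qed

text \<open>
  The image of $\beta F_{K-1} \alpha^{-1}$ is $\sigma(\beta) F_K \sigma(\alpha)^{-1}$, that is
  $ab F_K a^{-1}$ or $a F_K (ab)^{-1}$, according to the parity of $K$.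
\<close>

lemma sing_step:
  "even K \<Longrightarrow> morph (sing (int K - 1)) = La # sing (int K)"
  "odd K \<Longrightarrow> sing (int K) = morph (sing (int K - 1)) @ [La]"
proof -
  have "(even K \<longrightarrow> morph (sing (int K - 1)) = La # sing (int K)) \<and>
    (odd K \<longrightarrow> sing (int K) = morph (sing (int K - 1)) @ [La])"
  proof (cases K)
    case 0
    then show ?thesis using sing_Fw[of 0] by (simp add: sing_minus_1 Fw_0)
  next
    case (Suc k)
    define u where "u = butlast (Fw (int k))"
    have "Fw (int (Suc k)) = morph u @ \<sigma> (if even k then La else Lb)"
      unfolding u_def by (subst Fw_Suc, subst Fw_last) simp
    then show ?thesis
      using sing_Fw[of k] sing_Fw[of "Suc k"] Suc by (simp add: u_def butlast_append)
  qed
  then show "even K \<Longrightarrow> morph (sing (int K - 1)) = La # sing (int K)"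
    "odd K \<Longrightarrow> sing (int K) = morph (sing (int K - 1)) @ [La]" by blast+
qed

lemma sing_last: "\<exists>v. sing (int K - 1) = v @ [if even K then La else Lb]"
proof (induction K)
  case 0
  show ?case by (simp add: sing_minus_1)
next
  case (Suc K)
  show ?case
  proof (cases "even K")
    case True
    then obtain v where "sing (int K - 1) = v @ [La]" using Suc by auto
    then have "La # sing (int K) = (morph v @ [La]) @ [Lb]" using sing_step(1)[OF True] by simp
    then have "sing (int K) = tl (morph v @ [La]) @ [Lb]"
      by (metis list.sel(3) snoc_eq_iff_butlast tl_append2)
    then show ?thesis using True by simp
  next
    case False
    then show ?thesis using sing_step(2)[of K] by simp
  qed
qed

lemma length_sing: "length (sing (int K - 1)) = fib (K + 1)"
proof (cases K)
  case (Suc k)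
  have "fib (k + 2) > 0" by (rule fib_neq_0_nat) simp
  then show ?thesis using Suc by (simp add: sing_Fw length_Fw)
qed (simp add: sing_minus_1)

lemma pos_fib_pred: "pos (fib (K + 2) - 1) + (if even K then 2 else 1) = fib (K + 3)"
proof -
  define N where "N = fib (K + 2) - 1"
  have "fib (K + 2) > 0" by (rule fib_neq_0_nat) simp
  then have N: "fib (K + 2) = Suc N" by (simp add: N_def)
  have "length (butlast (Fw (int K))) = N" using N length_Fw[of K] by simp
  then have "Fw (int K) ! N = (if even K then La else Lb)"
    by (subst Fw_last) (simp add: nth_append)
  then have "ltr N = (if even K then La else Lb)"
    using fibx_nth[of N K] N length_Fw[of K] by simp
  then have "pos (Suc N) = pos N + (if even K then 2 else 1)" by (simp add: pos_Suc)
  moreover have "pos (Suc N) = fib (K + 3)" using pos_fib[of K] N by simp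
  ultimately show ?thesis by (simp add: N_def)
qed

text \<open>
  Even $K$ needs more than desubstitution: there $s_K$ begins and ends with $b$, and a $b$ has the
  letter $a$ on both sides, so $s_K$ extends to $a s_K a = \sigma(s_{K-1})a$.
\<close>

lemma occurs_sing_step:
  "occurs_at (sing (int K)) q \<longleftrightarrow>
   (\<exists>i. q = pos i + (if even K then 1 else 0) \<and> occurs_at (sing (int K - 1)) i)"
proof (cases "even K")
  case False
  then show ?thesis by (simp add: sing_step(2) desubstitution)
next
  case True
  have step: "morph (sing (int K - 1)) @ [La] = La # sing (int K) @ [La]"
    using sing_step(1)[OF True] by simp
  show ?thesis
  proof
    assume q: "occurs_at (sing (int K)) q"
    have "ltr q = Lb" using q True by (simp add: sing_Fw)
    then have prev: "q > 0" "ltr (q - 1) = La" using ltr_Lb_neighbours by blast+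
    \<comment> \<open>The letter after the final $b$ is the $a$ that desubstitution requires.\<close>
    obtain v where v: "sing (int K) = v @ [Lb]" using sing_last[of "Suc K"] True by auto
    then have "ltr (q + length v) = Lb" using q by (simp add: occurs_at_append)
    then have "ltr (q + length (sing (int K))) = La" using ltr_Lb_neighbours(3) v by simp
    then have "occurs_at (morph (sing (int K - 1)) @ [La]) (q - 1)"
      unfolding step using q prev by (simp add: occurs_at_append)
    then obtain i where "q - 1 = pos i" "occurs_at (sing (int K - 1)) i"
      unfolding desubstitution by blast
    then show "\<exists>i. q = pos i + (if even K then 1 else 0) \<and> occurs_at (sing (int K - 1)) i"
      using True prev by (intro exI[of _ i]) auto
  next
    assume "\<exists>i. q = pos i + (if even K then 1 else 0) \<and> occurs_at (sing (int K - 1)) i"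
    then obtain i where i: "q = Suc (pos i)" "occurs_at (sing (int K - 1)) i" using True by auto
    then have "occurs_at (La # sing (int K) @ [La]) (pos i)"
      unfolding step[symmetric] desubstitution by blast
    then show "occurs_at (sing (int K)) q" using i by (simp add: occurs_at_append)
  qed
qed

text \<open>
  Singular words force the whole central word around them.  Both families are produced by
  desubstitution, so the offsets on the two sides evolve in the same way; that they differ by
  $f_K - 1$ at each stage is a count of images of letters.
\<close>

lemma occurs_sing:
  "occurs_at (sing (int K - 1)) q \<longleftrightarrow>
   (\<exists>t. q + 1 = t + fib (K + 2) \<and> occurs_at (central K) t)"
proof (induction K arbitrary: q)
  case 0
  show ?case by (simp add: sing_minus_1 central_0)
next
  case (Suc K)
  define c :: nat where "c = (if even K then 1 else 0)"
  have shift: "pos i + c + 1 = pos t + fib (K + 3)"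
    if "i + 1 = t + fib (K + 2)" "occurs_at (central K) t" for i t
  proof -
    have f: "fib (K + 2) > 0" using fib_pos[of "K + 1"] by simp
    then have "i = t + (fib (K + 2) - 1)" using that(1) by simp
    moreover have "fib (K + 2) - 1 \<le> fib (K + 4) - 2"
      using fib_central[of K] f fib_pos[of K] by linarith
    ultimately have "pos i = pos t + pos (fib (K + 2) - 1)"
      using pos_add_of_occurs that(2) by (simp add: central_def)
    then show ?thesis using pos_fib_pred[of K] by (simp add: c_def split: if_splits)
  qed
  have "occurs_at (sing (int (Suc K) - 1)) q \<longleftrightarrow>
      (\<exists>i. q = pos i + c \<and> occurs_at (sing (int K - 1)) i)"
    by (simp add: occurs_sing_step c_def)
  also have "\<dots> \<longleftrightarrow> (\<exists>i t. q = pos i + c \<and> i + 1 = t + fib (K + 2) \<and> occurs_at (central K) t)"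
    using Suc.IH by blast
  also have "\<dots> \<longleftrightarrow> (\<exists>t. q + 1 = pos t + fib (K + 3) \<and> occurs_at (central K) t)"
  proof
    assume "\<exists>t. q + 1 = pos t + fib (K + 3) \<and> occurs_at (central K) t"
    then obtain t where t: "q + 1 = pos t + fib (K + 3)" "occurs_at (central K) t" by blast
    have "(t + fib (K + 2) - 1) + 1 = t + fib (K + 2)" using fib_pos[of "K + 1"] by simp
    then show "\<exists>i t. q = pos i + c \<and> i + 1 = t + fib (K + 2) \<and> occurs_at (central K) t"
      using shift t by (metis add_right_cancel)
  next
    assume "\<exists>i t. q = pos i + c \<and> i + 1 = t + fib (K + 2) \<and> occurs_at (central K) t"
    then show "\<exists>t. q + 1 = pos t + fib (K + 3) \<and> occurs_at (central K) t"
      using shift by blast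
  qed
  also have "\<dots> \<longleftrightarrow> (\<exists>t. q + 1 = t + fib (Suc K + 2) \<and> occurs_at (central (Suc K)) t)"
    unfolding occurs_central_Suc by (auto simp: numeral_3_eq_3)
  finally show ?case .
qed

lemma occurs_at_transfer:
  assumes "occurs_at (block 0 L) t" "occurs_at w (t + d)" "d + length w \<le> L"
    and "occurs_at (block 0 L) t'"
  shows "occurs_at w (t' + d)"
  unfolding occurs_at_nth
proof (intro allI impI)
  fix r assume r: "r < length w"
  then have "d + r < L" using assms(3) by simp
  then have "ltr (t + (d + r)) = ltr (d + r)" "ltr (t' + (d + r)) = ltr (d + r)"
    using assms(1,4) by (simp_all add: occurs_at_nth)
  then show "ltr (t' + d + r) = w ! r"
    using assms(2) r by (simp add: occurs_at_nth add.assoc)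
qed

text \<open>
  One occurrence of \<open>w\<close> lies within a central word, hence so does a copy of \<open>w\<close> in every central word,
  and conversely an occurrence of \<open>w\<close> contains its singular word and so determines a central word.
\<close>

lemma occurrences_around_sing:
  assumes w: "w = u @ sing (int K - 1) @ v"
    and len: "length u < fib (K + 2)" "length v < fib (K + 2)"
    and factor: "is_factor w"
  shows "occurs_at w q \<longleftrightarrow> (\<exists>t. q = t + (fib (K + 2) - 1 - length u) \<and> occurs_at (central K) t)"
proof -
  define d where "d = fib (K + 2) - 1 - length u"
  define L where "L = fib (K + 4) - 2"
  have central: "central K = block 0 L" by (simp add: central_def L_def)
  have "length w = length u + fib (K + 1) + length v"
    using w length_sing[of K] by simp
  then have dL: "d + length w \<le> L" using len fib_central[of K] by (simp add: d_def L_def)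
  have imp: "\<exists>t. q = t + d \<and> occurs_at (block 0 L) t" if "occurs_at w q" for q
  proof -
    have "occurs_at (sing (int K - 1)) (q + length u)" using that w by (simp add: occurs_at_append)
    then obtain t where "q + length u + 1 = t + fib (K + 2)" "occurs_at (central K) t"
      using occurs_sing by blast
    then show ?thesis using len by (intro exI[of _ t]) (auto simp: d_def central)
  qed
  obtain q0 where "occurs_at w q0" using factor is_factor_def by blast
  with imp obtain t0 where t0: "occurs_at w (t0 + d)" "occurs_at (block 0 L) t0" by blast
  show ?thesis
    unfolding d_def[symmetric] central using imp occurs_at_transfer[OF t0(2,1) dL] by blast
qed

lemma enumerate_first_three:
  fixes a b c :: nat
  assumes "a < b" "b < c" "a \<in> S" "b \<in> S" "c \<in> S"
    and only: "\<And>q. \<lbrakk>q \<in> S; q \<le> c\<rbrakk> \<Longrightarrow> q \<in> {a, b, c}"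
  shows "enumerate S 0 = a" "enumerate S 1 = b" "enumerate S 2 = c"
proof -
  have "a \<le> q" if "q \<in> S" for q
    using that only[of q] assms(1,2) by force
  then have a: "(LEAST q. q \<in> S) = a" using assms(3) by (intro Least_equality)
  have "b \<le> q" if "q \<in> S - {a}" for q
    using that only[of q] assms(2) by force
  then have b: "(LEAST q. q \<in> S - {a}) = b" using assms(1,4) by (intro Least_equality) auto
  have "c \<le> q" if "q \<in> S - {a} - {b}" for q
    using that only[of q] by force
  then have c: "(LEAST q. q \<in> S - {a} - {b}) = c" using assms(1,2,5) by (intro Least_equality) auto
  show "enumerate S 0 = a" "enumerate S 1 = b" "enumerate S 2 = c"
    using a b c by (simp_all add: enumerate_0 enumerate_Suc numeral_2_eq_2)
qed

lemma offsets_around_sing: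
  assumes "w = u @ sing (int K - 1) @ v"
    and "length u < fib (K + 2)" "length v < fib (K + 2)"
    and "is_factor w"
  shows "offset w 1 = fib (K + 2) - 1 - length u"
    and "offset w 2 = fib (K + 3) + (fib (K + 2) - 1 - length u)"
    and "offset w 3 = fib (K + 4) + (fib (K + 2) - 1 - length u)"
proof -
  define d where "d = fib (K + 2) - 1 - length u"
  have S: "{q. occurs_at w q} = (\<lambda>t. t + d) ` {t. occurs_at (central K) t}"
    using occurrences_around_sing[OF assms] by (auto simp: d_def)
  have "0 < fib (K + 3)" "fib (K + 3) < fib (K + 4)"
    using fib_less_Suc[of "K + 3"] fib_pos[of "K + 2"] by (simp_all add: eval_nat_numeral)
  then have "enumerate {q. occurs_at w q} 0 = d \<and> enumerate {q. occurs_at w q} 1 = fib (K + 3) + d \<and>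
      enumerate {q. occurs_at w q} 2 = fib (K + 4) + d"
    using central_first_three[of K]
    by (intro conjI enumerate_first_three[of d "fib (K + 3) + d" "fib (K + 4) + d"])
      (auto simp: S)
  then show "offset w 1 = fib (K + 2) - 1 - length u"
    "offset w 2 = fib (K + 3) + (fib (K + 2) - 1 - length u)"
    "offset w 3 = fib (K + 4) + (fib (K + 2) - 1 - length u)"
    by (simp_all add: offset_def d_def)
qed

lemma occurs_at_central_1: "occurs_at (central (Suc 0)) i \<longleftrightarrow> ltr i = La \<and> ltr (Suc i) = Lb"
  using ltr_Lb_neighbours(3)[of "Suc i"] by (auto simp: central_0 central_Suc)

text \<open>
  For two letters $a$ the dichotomy is whether the first is followed by $b$, and then
  $aba$ starts at it, or by $a$, and then $aa$ is in the middle of $abaaba$.  The inequalities imply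
  that the singular word in the middle of the larger central word lies within the span of the two
  singular words in the middle of the smaller ones.
\<close>

lemma between_central_occurrences:
  assumes "i < j" "occurs_at (central K) i" "occurs_at (central K) j"
  shows "(\<exists>t. occurs_at (central (K + 1)) t \<and> i \<le> t \<and> t + fib (K + 3) \<le> j) \<or>
    (\<exists>t. occurs_at (central (K + 2)) t \<and> i \<le> t + fib (K + 3) \<and> t + fib (K + 4) \<le> j)"
  using assms
proof (induction K arbitrary: i j)
  case 0
  then have a: "ltr i = La" "ltr j = La" by (simp_all add: central_0)
  show ?case
  proof (cases "ltr (Suc i)")
    case Lb
    then have "j \<noteq> Suc i" using a by auto
    then have "occurs_at (central (0 + 1)) i \<and> i \<le> i \<and> i + fib (0 + 3) \<le> j"
      using 0(1) a Lb occurs_at_central_1[of i] by (simp add: fib_small)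
    then show ?thesis by blast
  next
    case La
    \<comment> \<open>The first $a$ of $aa$ is $\sigma(b)$; this $b$ is the middle of $aba$, and $\sigma(aba)a = abaaba$.\<close>
    obtain r where r: "i = pos r" using a(1) by (rule ltr_La_pos)
    then have "ltr r = Lb" using La by (cases r rule: pos_cases) simp_all
    then have "r > 0" "ltr (r - 1) = La" using ltr_Lb_neighbours by blast+
    then obtain r' where r': "r = Suc r'" "ltr r' = La" by (cases r) auto
    then have "occurs_at (central (Suc 0)) r'" using \<open>ltr r = Lb\<close> by (simp add: occurs_at_central_1)
    then have "occurs_at (central (Suc (Suc 0))) (pos r')" unfolding occurs_central_Suc by blast
    moreover have "i = pos r' + 2" using r r' by (simp add: pos_Suc)
    ultimately have "occurs_at (central (0 + 2)) (pos r') \<and> i \<le> pos r' + fib (0 + 3) \<and> pos r' + fib (0 + 4) \<le> j"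
      using 0(1) by (simp add: fib_small numeral_2_eq_2)
    then show ?thesis by blast
  qed
next
  case (Suc K)
  have mono: "x \<le> y \<longleftrightarrow> pos x \<le> pos y" for x y
    using strict_mono_pos by (simp add: strict_mono_less_eq)
  have shift: "pos (t + fib (K' + 2)) = pos t + fib (K' + 3)"
    if "occurs_at (central L) t" "K' \<le> L" for t K' L
  proof -
    have "fib (K' + 2) \<le> fib (L + 2)" using that(2) by (intro fib_mono) simp
    then have "fib (K' + 2) \<le> fib (L + 4) - 2"
      using fib_central[of L] fib_pos[of L] fib_pos[of "Suc L"] by simp
    then show ?thesis using pos_add_of_occurs[of "fib (L + 4) - 2" t] that(1) pos_fib[of K']
      by (simp add: central_def)
  qed
  obtain i' j' where ij: "i = pos i'" "occurs_at (central K) i'" "j = pos j'" "occurs_at (central K) j'"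
    using Suc.prems occurs_central_Suc by blast
  then have "i' < j'" using Suc.prems(1) strict_mono_pos by (simp add: strict_mono_less)
  from Suc.IH[OF this ij(2,4)] show ?case
  proof (elim disjE exE conjE)
    fix t
    assume t: "occurs_at (central (K + 1)) t" "i' \<le> t" "t + fib (K + 3) \<le> j'"
    have "pos (t + fib (K + 3)) = pos t + fib (K + 4)"
      using shift[of "K + 1" t "K + 1"] t(1) by (simp add: eval_nat_numeral)
    then have "occurs_at (central (Suc K + 1)) (pos t) \<and> i \<le> pos t \<and> pos t + fib (Suc K + 3) \<le> j"
      using t ij occurs_central_Suc[of "K + 1" "pos t"] mono[of i' t] mono[of "t + fib (K + 3)" j']
      by (auto simp: eval_nat_numeral)
    then show ?thesis by blast
  next
    fix t
    assume t: "occurs_at (central (K + 2)) t" "i' \<le> t + fib (K + 3)" "t + fib (K + 4) \<le> j'"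
    have "pos (t + fib (K + 3)) = pos t + fib (K + 4)" "pos (t + fib (K + 4)) = pos t + fib (K + 5)"
      using shift[of "K + 2" t "K + 1"] shift[of "K + 2" t "K + 2"] t(1)
      by (simp_all add: eval_nat_numeral)
    then have "occurs_at (central (Suc K + 2)) (pos t) \<and> i \<le> pos t + fib (Suc K + 3) \<and>
        pos t + fib (Suc K + 4) \<le> j"
      using t ij occurs_central_Suc[of "K + 2" "pos t"] mono[of i' "t + fib (K + 3)"]
        mono[of "t + fib (K + 4)" j']
      by (auto simp: eval_nat_numeral)
    then show ?thesis by blast
  qed
qed

text \<open>
  Hence a longest singular factor is not repeated, unless $a$ and $b$ tie as in $aba$.
\<close>

lemma between_sing_occurrences:
  assumes "i < j" "occurs_at (sing (int K - 1)) i" "occurs_at (sing (int K - 1)) j"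
  obtains K' l where "K < K'" "i \<le> l" "occurs_at (sing (int K' - 1)) l"
    "l + fib (K' + 1) \<le> j + fib (K + 1)"
proof -
  obtain s t where s: "i + 1 = s + fib (K + 2)" "occurs_at (central K) s"
    and t: "j + 1 = t + fib (K + 2)" "occurs_at (central K) t"
    using assms(2,3) unfolding occurs_sing by blast
  have f3: "fib (K + 3) = fib (K + 2) + fib (K + 1)" and f4: "fib (K + 4) = fib (K + 3) + fib (K + 2)"
    by (simp_all add: fib.simps(3) eval_nat_numeral)
  have pos: "fib (K + 2) > 0" "fib (K + 1) > 0" using fib_pos[of K] fib_pos[of "K + 1"] by simp_all
  have "s < t" using s t assms(1) by linarith
  from between_central_occurrences[OF this s(2) t(2)] show ?thesis
  proof (elim disjE exE conjE)
    fix r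
    assume r: "occurs_at (central (K + 1)) r" "s \<le> r" "r + fib (K + 3) \<le> t"
    have "occurs_at (sing (int (K + 1) - 1)) (r + fib (K + 3) - 1)"
      unfolding occurs_sing using r(1) pos f3 by (intro exI[of _ r]) (simp add: eval_nat_numeral)
    moreover have "i \<le> r + fib (K + 3) - 1"
      using s(1) r(2) f3 by linarith
    moreover have "r + fib (K + 3) - 1 + fib (K + 1 + 1) \<le> j + fib (K + 1)"
      using t(1) r(3) f3 pos by simp
    ultimately show ?thesis using that[of "K + 1"] by simp
  next
    fix r
    assume r: "occurs_at (central (K + 2)) r" "s \<le> r + fib (K + 3)" "r + fib (K + 4) \<le> t"
    have "occurs_at (sing (int (K + 2) - 1)) (r + fib (K + 4) - 1)"
      unfolding occurs_sing using r(1) pos f4 by (intro exI[of _ r]) (simp add: eval_nat_numeral)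
    moreover have "i \<le> r + fib (K + 4) - 1"
      using s(1) r(2) f4 by linarith
    moreover have "r + fib (K + 4) - 1 + fib (K + 2 + 1) \<le> j + fib (K + 1)"
      using t(1) r(3) f3 f4 pos by (simp add: eval_nat_numeral)
    ultimately show ?thesis using that[of "K + 2"] by simp
  qed
qed

section \<open>The singular decomposition\<close>

lemma is_singular_iff: "is_singular v \<longleftrightarrow> (\<exists>K::nat. v = sing (int K - 1))"
proof
  assume "is_singular v"
  then obtain k where "k \<ge> - 1" "v = sing k" by (auto simp: is_singular_def)
  then show "\<exists>K::nat. v = sing (int K - 1)" by (intro exI[of _ "nat (k + 1)"]) simp
next
  assume "\<exists>K::nat. v = sing (int K - 1)"
  then obtain K :: nat where "v = sing (int K - 1)" by blast
  then show "is_singular v" unfolding is_singular_def by (intro exI[of _ "int K - 1"]) simp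
qed

lemma sing_0: "sing 0 = [Lb]"
  by (simp add: sing_def Fw_0)

lemma sing_inj: "sing (int K - 1) = sing (int K' - 1) \<Longrightarrow> K = K'"
proof (induction K K' rule: linorder_wlog)
  case (le K K')
  show ?case
  proof (rule ccontr)
    assume "K \<noteq> K'"
    then have "fib (K + 1) < fib (K' + 1) \<or> (K = 0 \<and> K' = 1)"
      using le by (intro fib_Suc_less) simp
    moreover have "fib (K + 1) = fib (K' + 1)" using le length_sing by metis
    ultimately show False using le by (auto simp: sing_minus_1 sing_0)
  qed
qed simp

lemma sublist_occurs:
  assumes "occurs_at w q" "occurs_at v l" "q \<le> l" "l + length v \<le> q + length w"
  shows "sublist v w"
proof -
  have "w = block q (q + length w)" using assms(1) by (rule occurs_at_blockD)
  also have "\<dots> = block q l @ block l (l + length v) @ block (l + length v) (q + length w)"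
    using assms(3,4) by (simp add: block_append)
  also have "block l (l + length v) = v" using occurs_at_blockD[OF assms(2)] by simp
  finally show ?thesis unfolding sublist_def by blast
qed

text \<open>
  These are the factors in which $a$ and $b$ could tie as longest singular words: as $bb$ is not a
  factor, the letters of such a word alternate, and four of them contain $bab$.
\<close>

lemma factor_without_aa_bab:
  assumes "is_factor w" "\<not> sublist [La, La] w" "\<not> sublist [Lb, La, Lb] w"
  shows "length w \<le> 1 \<or> w \<in> {[La, Lb], [Lb, La], [La, Lb, La]}"
proof -
  obtain q where q: "occurs_at w q" using assms(1) by (auto simp: is_factor_def)
  have alt: "y = (if x = La then Lb else La)"
    if xy: "sublist [x, y] w" for x y
  proof -
    obtain ps ss where "w = ps @ [x, y] @ ss" using xy unfolding sublist_def by blast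
    then have "occurs_at [x, y] (q + length ps)" using q by (simp add: occurs_at_append)
    then show ?thesis
      using xy assms(2) ltr_Lb_neighbours(3)[of "q + length ps"] by (cases x; cases y) auto
  qed
  consider "length w \<le> 1" | x y where "w = [x, y]" | x y z where "w = [x, y, z]"
    | x y z t us where "w = x # y # z # t # us"
    by (metis One_nat_def le_SucI le_zero_eq length_0_conv length_Cons neq_Nil_conv not_less_eq_eq)
  then show ?thesis
  proof cases
    case 2
    then show ?thesis using alt[of x y] by (cases x) auto
  next
    case 3
    then show ?thesis using alt[of x y] alt[of y z] assms(3) by (cases x) (auto simp: sublist_Cons_right)
  next
    case 4
    then show ?thesis using alt[of x y] alt[of y z] alt[of z t] assms(3)
      by (cases x) (auto simp: sublist_Cons_right)
  qed simp
qed

text \<open>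
  Only $s_{-1} = a$ and $s_0 = b$ have the same length, and if these are the longest singular factors,
  there is neither $s_1 = aa$ nor $s_2 = bab$.
\<close>

lemma longest_singular_factor_unique:
  assumes "regular_factor w"
    and "is_singular v" "sublist v w" "\<And>v'. \<lbrakk>is_singular v'; sublist v' w\<rbrakk> \<Longrightarrow> length v' \<le> length v"
    and "is_singular u" "sublist u w" "length u = length v"
  shows "u = v"
proof -
  obtain K K' where K: "v = sing (int K - 1)" and K': "u = sing (int K' - 1)"
    using assms(2,5) is_singular_iff by blast
  then have eq: "fib (K + 1) = fib (K' + 1)" using assms(7) length_sing by metis
  have False if ne: "K \<noteq> K'"
  proof -
    have "{K, K'} = {0, 1}"
      using fib_Suc_less[of K K'] fib_Suc_less[of K' K] eq ne by (cases "K < K'") auto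
    then have "length v = 1" and both: "sublist [La] w" "sublist [Lb] w"
      using K K' assms(3,6) by (auto simp: doubleton_eq_iff sing_minus_1 sing_0)
    have "is_singular [La, La]" "is_singular [Lb, La, Lb]"
    proof -
      have 1: "sing (int 1) = [La, La]" using sing_step(2)[of 1] by (simp add: sing_0)
      then have "La # sing (int 2) = La # [Lb, La, Lb]" using sing_step(1)[of 2] by simp
      then show "is_singular [La, La]" "is_singular [Lb, La, Lb]"
        using 1 unfolding is_singular_def by (metis list.inject of_nat_0_le_iff order_trans
          neg_le_0_iff_le zero_le_one)+
    qed
    then have "\<not> sublist [La, La] w" "\<not> sublist [Lb, La, Lb] w"
      using assms(4) \<open>length v = 1\<close> by fastforce+
    then have "length w \<le> 1" using factor_without_aa_bab assms(1) by (auto simp: regular_factor_def)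
    then show False using both by (cases w) (auto simp: sublist_Cons_right)
  qed
  then show ?thesis using K K' by blast
qed

lemma sk_longest:
  assumes "regular_factor w"
  shows "is_singular (sk w)" "sublist (sk w) w"
    "\<And>v. \<lbrakk>is_singular v; sublist v w\<rbrakk> \<Longrightarrow> length v \<le> length (sk w)"
proof -
  let ?P = "\<lambda>v. is_singular v \<and> sublist v w"
  have "w \<noteq> []" using assms by (simp add: regular_factor_def)
  then obtain c w' where w: "w = c # w'" by (cases w) auto
  have "?P [c]"
  proof
    have "[c] = sing (if c = La then - 1 else 0)" by (cases c) (simp_all add: sing_minus_1 sing_0)
    then show "is_singular [c]" unfolding is_singular_def
      by (metis neg_le_0_iff_le order_refl zero_le_one)
    show "sublist [c] w" by (simp add: w)
  qed
  moreover have "\<forall>v. ?P v \<longrightarrow> length v < Suc (length w)"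
    using sublist_length_le by (auto simp: less_Suc_eq_le)
  ultimately obtain v where v: "?P v" "\<forall>v'. ?P v' \<longrightarrow> length v' \<le> length v"
    using ex_has_greatest_nat[of ?P "[c]" length "Suc (length w)"] by blast
  have "sk w = v"
    unfolding sk_def
  proof (rule the_equality)
    fix u
    assume u: "is_singular u \<and> sublist u w \<and>
      (\<forall>v'. is_singular v' \<and> sublist v' w \<longrightarrow> length v' \<le> length u)"
    then have "length u = length v" using v by (meson order_antisym)
    then show "u = v" using longest_singular_factor_unique[OF assms, of v u] u v by blast
  qed (use v in blast)
  then show "is_singular (sk w)" "sublist (sk w) w"
    "\<And>v. \<lbrakk>is_singular v; sublist v w\<rbrakk> \<Longrightarrow> length v \<le> length (sk w)"
    using v by auto
qed

text \<open>
  Two occurrences would have a singular word of larger index between them, which is no shorter and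
  different.
\<close>

lemma sk_occurs_once:
  assumes w: "regular_factor w" and q: "occurs_at w q"
    and i: "occurs_at (sk w) i" "q \<le> i" "i + length (sk w) \<le> q + length w"
    and j: "occurs_at (sk w) j" "q \<le> j" "j + length (sk w) \<le> q + length w"
  shows "i = j"
proof -
  obtain K where K: "sk w = sing (int K - 1)" using sk_longest(1)[OF w] is_singular_iff by blast
  have "\<not> i < j" if i: "occurs_at (sk w) i" "q \<le> i" "i + length (sk w) \<le> q + length w"
    and j: "occurs_at (sk w) j" "q \<le> j" "j + length (sk w) \<le> q + length w" for i j
  proof
    assume "i < j"
    then obtain K' l where l: "K < K'" "i \<le> l" "occurs_at (sing (int K' - 1)) l"
      "l + fib (K' + 1) \<le> j + fib (K + 1)"
      using between_sing_occurrences i(1) j(1) unfolding K by metis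
    have sub: "sublist (sing (int K' - 1)) w"
      using l i(2) j(3) by (intro sublist_occurs[OF q l(3)]) (simp_all add: K length_sing)
    have sing: "is_singular (sing (int K' - 1))" using is_singular_iff by blast
    have "fib (K + 1) \<le> fib (K' + 1)" using l(1) by (intro fib_mono) simp
    then have "length (sing (int K' - 1)) = length (sk w)"
      using sk_longest(3)[OF w sing sub] unfolding K length_sing by simp
    then have "sing (int K' - 1) = sk w"
      using longest_singular_factor_unique[OF w sk_longest[OF w] sing sub] by blast
    then show False using sing_inj[of K' K] K l(1) by simp
  qed
  from this[OF i j] this[OF j i] show ?thesis by simp
qed

lemma singular_decomposition:
  assumes w: "regular_factor w"
  shows "w = \<mu>1 w @ sk w @ \<mu>2 w"
proof -
  obtain u v where uv: "w = u @ sk w @ v" using sk_longest(2)[OF w] unfolding sublist_def by blast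
  obtain q where q: "occurs_at w q" using w by (auto simp: regular_factor_def is_factor_def)
  have "sing_decomp w = (u, v)" unfolding sing_decomp_def
  proof (rule the_equality)
    show "case (u, v) of (u, v) \<Rightarrow> w = u @ sk w @ v" using uv by simp
    fix p assume "case p of (u, v) \<Rightarrow> w = u @ sk w @ v"
    then obtain u' v' where p: "p = (u', v')" and uv': "w = u' @ sk w @ v'" by (cases p) auto
    have occ: "occurs_at (sk w) (q + length x)" "q + length x + length (sk w) \<le> q + length w"
      if "w = x @ sk w @ y" for x y
    proof -
      have "occurs_at (x @ sk w @ y) q" using q that by simp
      then show "occurs_at (sk w) (q + length x)" by (simp add: occurs_at_append)
      have "length w = length x + length (sk w) + length y"
        using arg_cong[OF that, of length] by simp
      then show "q + length x + length (sk w) \<le> q + length w" by simp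
    qed
    have "q + length u = q + length u'"
      by (intro sk_occurs_once[OF w q]) (use occ[OF uv] occ[OF uv'] in simp_all)
    then have "length u = length u'" by simp
    then show "p = (u, v)" using uv uv' p by (metis append_eq_append_conv)
  qed
  then show ?thesis using uv by (simp add: \<mu>1_def \<mu>2_def)
qed

section \<open>Gaps\<close>

text \<open>
  Consecutive occurrences are $f_{K+1}$ and then $f_K$ apart, so the sign of each gap depends only on
  how $|\omega|$ compares with these two numbers, and its length is the difference.
\<close>

lemma gaps_around_sing:
  assumes w: "w = u @ sing (int K - 1) @ v" "is_factor w"
    and len: "length u < fib (K + 2)" "length v < fib (K + 2)"
  defines "d \<equiv> fib (K + 2) - 1 - length u" and "n \<equiv> length w"
  shows "n \<le> fib (K + 3) \<Longrightarrow> gap w 1 = of_word (block (d + n) (fib (K + 3) + d))"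
    and "n > fib (K + 3) \<Longrightarrow> finv (gap w 1) = of_word (block (fib (K + 3) + d) (d + n))"
    and "flen (gap w 1) = int (fib (K + 3)) - int n"
    and "n \<le> fib (K + 2) \<Longrightarrow> gap w 2 = of_word (block (fib (K + 3) + d + n) (fib (K + 4) + d))"
    and "n > fib (K + 2) \<Longrightarrow> finv (gap w 2) = of_word (block (fib (K + 4) + d) (fib (K + 3) + d + n))"
    and "flen (gap w 2) = int (fib (K + 2)) - int n"
proof -
  have offset: "offset w 1 = d" "offset w 2 = fib (K + 3) + d" "offset w 3 = fib (K + 4) + d"
    using offsets_around_sing[OF w(1) len w(2)] by (simp_all add: d_def)
  have f4: "fib (K + 4) = fib (K + 3) + fib (K + 2)" by (simp add: fib.simps(3) eval_nat_numeral)
  have "gap w 1 = (if n \<le> fib (K + 3) then of_word (block (d + n) (fib (K + 3) + d))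
      else finv (of_word (block (fib (K + 3) + d) (d + n))))"
    unfolding gap_def Let_def using offset by (auto simp: n_def numeral_2_eq_2)
  then show "n \<le> fib (K + 3) \<Longrightarrow> gap w 1 = of_word (block (d + n) (fib (K + 3) + d))"
    and "n > fib (K + 3) \<Longrightarrow> finv (gap w 1) = of_word (block (fib (K + 3) + d) (d + n))"
    and "flen (gap w 1) = int (fib (K + 3)) - int n"
    by (auto simp: finv_finv flen_finv flen_of_word)
  have "gap w 2 = (if n \<le> fib (K + 2) then of_word (block (fib (K + 3) + d + n) (fib (K + 4) + d))
      else finv (of_word (block (fib (K + 4) + d) (fib (K + 3) + d + n))))"
    unfolding gap_def Let_def using offset f4 by (auto simp: n_def numeral_2_eq_2 numeral_3_eq_3)
  then show "n \<le> fib (K + 2) \<Longrightarrow> gap w 2 = of_word (block (fib (K + 3) + d + n) (fib (K + 4) + d))"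
    and "n > fib (K + 2) \<Longrightarrow> finv (gap w 2) = of_word (block (fib (K + 4) + d) (fib (K + 3) + d + n))"
    and "flen (gap w 2) = int (fib (K + 2)) - int n"
    using f4 by (auto simp: finv_finv flen_finv flen_of_word)
qed

text \<open>
  From $f_{K+1}$ on, each Fibonacci number is an offset of a central word that is at least as
  long as the $K$-th one.
\<close>

lemma ltr_fib_add:
  assumes "K + 3 \<le> j" "s < fib (K + 4) - 2"
  shows "ltr (fib j + s) = ltr s"
proof -
  have "fib (K + 4) \<le> fib (j - 3 + 4)" using assms(1) by (intro fib_mono) simp
  then have "s < fib (j - 3 + 4) - 2" using assms(2) by linarith
  moreover have "occurs_at (central (j - 3)) (fib j)"
    using central_first_three[of "j - 3"] assms(1) by simp
  ultimately show ?thesis by (simp add: central_def occurs_at_nth)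
qed

lemma block_fib_add:
  assumes "K + 3 \<le> j" "b \<le> fib (K + 4) - 2"
  shows "block (fib j + a) (fib j + b) = block a b"
  by (rule nth_equalityI) (use assms ltr_fib_add[of K j "a + _"] in \<open>auto simp: add.assoc\<close>)

lemma sub_eq_block:
  assumes "occurs_at w p" "1 \<le> i" "j \<le> int (length w)"
  shows "sub w i j = block (p + nat (i - 1)) (p + nat j)"
proof (rule nth_equalityI)
  show len: "length (sub w i j) = length (block (p + nat (i - 1)) (p + nat j))"
    using assms(2,3) by (auto simp: sub_def)
  fix r assume "r < length (sub w i j)"
  then have r: "r < p + nat j - (p + nat (i - 1))" unfolding len by simp
  then have "r < nat (j - i + 1)" "nat (i - 1) + r < length w" using assms(2,3) by linarith+
  then show "sub w i j ! r = block (p + nat (i - 1)) (p + nat j) ! r"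
    using assms(1) r by (simp add: sub_def occurs_at_nth add.assoc)
qed

lemma length_sub:
  assumes "1 \<le> i" "j \<le> int (length w)"
  shows "length (sub w i j) = nat (j - i + 1)"
  using assms by (auto simp: sub_def)

text \<open>
  The prefix of length $f_{l+2} - 2$ has period $f_l$, as its part after the first $f_l$
  letters is again a prefix of the sequence.
\<close>

lemma ltr_mod_fib: "s < fib (l + 4) - 2 \<Longrightarrow> ltr s = ltr (s mod fib (l + 2))"
proof (induction s rule: less_induct)
  case (less s)
  show ?case
  proof (cases "s < fib (l + 2)")
    case False
    then obtain t where s: "s = fib (l + 2) + t" using le_Suc_ex not_le by blast
    have pos: "fib (l + 2) > 0" using fib_pos[of "Suc l"] by simp
    then have t: "ltr t = ltr (t mod fib (l + 2))" using less s by simp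
    show ?thesis
    proof (cases l)
      case 0
      then show ?thesis using less.prems s by (simp add: fib_small)
    next
      case (Suc K)
      have "fib (l + 4) = fib (l + 2) + fib (K + 4)"
        using Suc by (simp add: fib.simps(3) eval_nat_numeral)
      then have "ltr s = ltr t"
        using ltr_fib_add[of K "l + 2" t] less.prems s Suc by simp
      then show ?thesis using t s by simp
    qed
  qed simp
qed

lemma block_eq_rotate:
  assumes "a + fib (l + 2) \<le> fib (l + 4) - 2"
  shows "block a (a + fib (l + 2)) = rotate a (Fw (int l))"
proof (rule nth_equalityI)
  show "length (block a (a + fib (l + 2))) = length (rotate a (Fw (int l)))"
    by (simp add: length_Fw)
  fix r assume "r < length (block a (a + fib (l + 2)))"
  then have r: "r < fib (l + 2)" by simp
  have "ltr (a + r) = ltr ((a + r) mod fib (l + 2))"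
    using r assms by (intro ltr_mod_fib) simp
  also have "\<dots> = Fw (int l) ! ((a + r) mod fib (l + 2))"
    using r by (intro fibx_nth) (simp add: length_Fw)
  also have "\<dots> = rotate a (Fw (int l)) ! r" using r by (simp add: nth_rotate length_Fw)
  finally show "block a (a + fib (l + 2)) ! r = rotate a (Fw (int l)) ! r" using r by simp
qed

lemma cyc_int: "cyc (int a) w = rotate a w"
  by (simp add: cyc_def nat_mod_as_int[symmetric] rotate_conv_mod[of a w] flip: of_nat_mod)

lemma sing_first_occurrence: "occurs_at (sing (int K - 1)) (fib (K + 2) - 1)"
  unfolding occurs_sing using fib_pos[of "Suc K"]
  by (intro exI[of _ 0]) (simp add: central_def)

lemma sing_occurs_at_fib:
  assumes "K + 3 \<le> j"
  shows "occurs_at (sing (int K - 1)) (fib j + (fib (K + 2) - 1))"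
  unfolding occurs_sing
proof (intro exI conjI)
  show "occurs_at (central K) (fib j)"
    using assms ltr_fib_add[of K j] by (simp add: central_def occurs_at_nth)
qed (use fib_pos[of "Suc K"] in simp)

text \<open>
  With $|\omega| = f_k$ admitted, this covers the singular words themselves: for them $\mu_1$ and
  $\mu_2$ are empty, and the two blocks are the complete words $s_{k+1}$ and $s_{k-1}$.
\<close>

lemma gaps_T1_1_T2_1:
  assumes w: "regular_factor w" and sk: "sk w = sing (int m)"
    and n: "n = int (length w)" "int (fib (m + 2)) \<le> n" "n < int (fib (m + 3))"
    and i: "0 \<le> i" "i \<le> n - int (fib (m + 2))"
    and \<mu>1: "\<mu>1 w = sub (sing (int m - 1)) (int (fib (m + 1)) - i + 1) (int (fib (m + 1)))"
    and \<mu>2: "\<mu>2 w = sub (sing (int m - 1)) 1 (n - int (fib (m + 2)) - i)"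
  shows "gap w 1 = of_word (sub (sing (int m + 1)) (n - int (fib (m + 2)) - i + 1) (int (fib (m + 3)) - i))"
    "flen (gap w 1) = int (fib (m + 4)) - n"
    "gap w 2 = of_word (sub (sing (int m - 1)) (n - int (fib (m + 2)) - i + 1) (int (fib (m + 1)) - i))"
    "flen (gap w 2) = int (fib (m + 3)) - n"
proof -
  define A B where AB: "A = fib m" "B = fib (m + 1)"
  have B: "B > 0" using fib_pos[of m] AB by simp
  note f = fib_sums[of m, folded AB]
  note s = length_sing[of m, folded AB]
  have K: "m + 1 + 2 = m + 3" "m + 1 + 3 = m + 4" "m + 1 + 4 = m + 5" "int (m + 1) - 1 = int m"
    "m + 2 + 1 = m + 3" "m + 2 + 2 = m + 4" "int (m + 2) - 1 = int m + 1"
    by simp_all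
  have fac: "is_factor w" using w by (simp add: regular_factor_def)
  have \<mu>1_length: "length (\<mu>1 w) = nat i"
    unfolding \<mu>1 by (subst length_sub) (use i n f s AB in auto)
  have \<mu>2_length: "length (\<mu>2 w) = nat (n - int (fib (m + 2)) - i)"
    unfolding \<mu>2 by (subst length_sub) (use i n f s AB in auto)
  have dec: "w = \<mu>1 w @ sing (int m) @ \<mu>2 w" using singular_decomposition[OF w] sk by simp
  have bounds: "length (\<mu>1 w) < fib (m + 3)" "length (\<mu>2 w) < fib (m + 3)"
    unfolding \<mu>1_length \<mu>2_length using i n f by linarith+
  note G = gaps_around_sing[of w "\<mu>1 w" "m + 1" "\<mu>2 w", unfolded K, OF dec fac bounds]
  have "gap w 1 = of_word (block (fib (m + 3) - 1 - length (\<mu>1 w) + length w)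
      (fib (m + 4) + (fib (m + 3) - 1 - length (\<mu>1 w))))"
    using n f by (intro G(1)) linarith
  also have "block (fib (m + 3) - 1 - length (\<mu>1 w) + length w)
      (fib (m + 4) + (fib (m + 3) - 1 - length (\<mu>1 w))) =
      sub (sing (int m + 1)) (n - int (fib (m + 2)) - i + 1) (int (fib (m + 3)) - i)"
  proof (subst sub_eq_block)
    show "occurs_at (sing (int m + 1)) (fib (m + 4) - 1)"
      using sing_first_occurrence[of "m + 2"] unfolding K .
    show "int (fib (m + 3)) - i \<le> int (length (sing (int m + 1)))"
      using length_sing[of "m + 2"] i unfolding K by simp
  qed (use i n f B \<mu>1_length in \<open>auto intro!: arg_cong2[where f = block]\<close>)
  finally show "gap w 1 = of_word (sub (sing (int m + 1)) (n - int (fib (m + 2)) - i + 1) (int (fib (m + 3)) - i))" .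
  have "gap w 2 = of_word (block (fib (m + 4) + (fib (m + 3) - 1 - length (\<mu>1 w)) + length w)
      (fib (m + 5) + (fib (m + 3) - 1 - length (\<mu>1 w))))"
    using n f by (intro G(4)) linarith
  also have "block (fib (m + 4) + (fib (m + 3) - 1 - length (\<mu>1 w)) + length w)
      (fib (m + 5) + (fib (m + 3) - 1 - length (\<mu>1 w))) =
      sub (sing (int m - 1)) (n - int (fib (m + 2)) - i + 1) (int (fib (m + 1)) - i)"
  proof (subst sub_eq_block)
    show "occurs_at (sing (int m - 1)) (fib (m + 5) + (fib (m + 2) - 1))"
      by (rule sing_occurs_at_fib) simp
    show "int (fib (m + 1)) - i \<le> int (length (sing (int m - 1)))"
      using length_sing[of m] i by simp
  qed (use i n f B AB \<mu>1_length in \<open>auto intro!: arg_cong2[where f = block]\<close>)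
  finally show "gap w 2 = of_word (sub (sing (int m - 1)) (n - int (fib (m + 2)) - i + 1) (int (fib (m + 1)) - i))" .
  show "flen (gap w 1) = int (fib (m + 4)) - n" "flen (gap w 2) = int (fib (m + 3)) - n"
    using G(3,6) n by simp_all
qed

lemma gaps_T1_1:
  assumes w: "regular_factor w" and sk: "sk w = sing (int m)" and len: "length w = fib (m + 2)"
  shows "gap w 1 = of_word (sing (int m + 1))" "gap w 2 = of_word (sing (int m - 1))"
    "flen (gap w 1) = int (fib (m + 3))" "flen (gap w 2) = int (fib (m + 1))"
proof -
  have K: "m + 1 + 1 = m + 2" "int (m + 1) - 1 = int m"
    "m + 2 + 1 = m + 3" "int (m + 2) - 1 = int m + 1"
    by simp_all
  have dec: "w = \<mu>1 w @ sing (int m) @ \<mu>2 w" using singular_decomposition[OF w] sk by simp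
  have "length w = length (\<mu>1 w) + fib (m + 2) + length (\<mu>2 w)"
    by (subst dec) (simp add: length_sing[of "m + 1", unfolded K])
  then have \<mu>: "\<mu>1 w = []" "\<mu>2 w = []" using len by auto
  have full: "sub v 1 (int (length v)) = v" for v by (simp add: sub_def)
  have "fib (m + 2) < fib (m + 3)" using fib_sums[of m] fib_pos[of m] by simp
  then have G: "gap w 1 = of_word (sub (sing (int m + 1)) 1 (int (fib (m + 3))))"
    "flen (gap w 1) = int (fib (m + 4)) - int (fib (m + 2))"
    "gap w 2 = of_word (sub (sing (int m - 1)) 1 (int (fib (m + 1))))"
    "flen (gap w 2) = int (fib (m + 3)) - int (fib (m + 2))"
    using gaps_T1_1_T2_1[OF w sk refl, of 0] \<mu> len by (simp_all add: sub_def)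
  then show "gap w 1 = of_word (sing (int m + 1))" "gap w 2 = of_word (sing (int m - 1))"
    "flen (gap w 1) = int (fib (m + 3))" "flen (gap w 2) = int (fib (m + 1))"
    using full[of "sing (int m + 1)"] full[of "sing (int m - 1)"] length_sing[of "m + 2"]
      length_sing[of m] fib_sums[of m] unfolding K by simp_all
qed

text \<open>
  The second and the third occurrence overlap, in a block to the right of the offset $f_{k+2}$, where
  a prefix longer than $F_{k+1}$ recurs; this is where the factor of $F_{k+1}$ comes from.
\<close>

lemma gaps_T2_2:
  assumes w: "regular_factor w" and sk: "sk w = sing (int m - 1)"
    and n: "n = int (length w)" "int (fib (m + 2)) < n" "n < int (fib (m + 3))"
    and i: "0 \<le> i" "i \<le> n - int (fib (m + 1))"
    and \<mu>1: "\<mu>1 w = sub (sing (int m)) (int (fib (m + 2)) - i + 1) (int (fib (m + 2)))"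
    and \<mu>2: "\<mu>2 w = sub (sing (int m)) 1 (n - int (fib (m + 1)) - i)"
  shows "gap w 1 = of_word (sub (sing (int m)) (n - int (fib (m + 1)) - i + 1) (int (fib (m + 2)) - i))"
    "flen (gap w 1) = int (fib (m + 3)) - n"
    "finv (gap w 2) = of_word (sub (Fw (int m + 1)) (int (fib (m + 2)) - i) (n - i - 1))"
    "flen (gap w 2) = int (fib (m + 2)) - n"
proof -
  define A B where AB: "A = fib m" "B = fib (m + 1)"
  have B: "B > 0" using fib_pos[of m] AB by simp
  note f = fib_sums[of m, folded AB]
  have K: "m + 1 + 1 = m + 2" "m + 1 + 2 = m + 3" "m + 1 + 3 = m + 4" "m + 1 + 4 = m + 5"
    "int (m + 1) - 1 = int m"
    by simp_all
  have K': "int (m + 1) = int m + 1" by simp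
  note s = length_sing[of "m + 1", unfolded K]
  have fac: "is_factor w" using w by (simp add: regular_factor_def)
  have \<mu>1_length: "length (\<mu>1 w) = nat i"
    unfolding \<mu>1 by (subst length_sub) (use i n f s AB in auto)
  have \<mu>2_length: "length (\<mu>2 w) = nat (n - int (fib (m + 1)) - i)"
    unfolding \<mu>2 by (subst length_sub) (use i n f s AB in auto)
  have dec: "w = \<mu>1 w @ sing (int m - 1) @ \<mu>2 w" using singular_decomposition[OF w] sk by simp
  have bounds: "length (\<mu>1 w) < fib (m + 2)" "length (\<mu>2 w) < fib (m + 2)"
    unfolding \<mu>1_length \<mu>2_length using i n f AB by linarith+
  note G = gaps_around_sing[of w "\<mu>1 w" m "\<mu>2 w", OF dec fac bounds]
  have "gap w 1 = of_word (block (fib (m + 2) - 1 - length (\<mu>1 w) + length w)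
      (fib (m + 3) + (fib (m + 2) - 1 - length (\<mu>1 w))))"
    using n f by (intro G(1)) linarith
  also have "block (fib (m + 2) - 1 - length (\<mu>1 w) + length w)
      (fib (m + 3) + (fib (m + 2) - 1 - length (\<mu>1 w))) =
      sub (sing (int m)) (n - int (fib (m + 1)) - i + 1) (int (fib (m + 2)) - i)"
  proof (subst sub_eq_block)
    show "occurs_at (sing (int m)) (fib (m + 3) - 1)"
      using sing_first_occurrence[of "m + 1"] unfolding K .
  qed (use i n f B AB s \<mu>1_length in \<open>auto intro!: arg_cong2[where f = block]\<close>)
  finally show "gap w 1 = of_word (sub (sing (int m)) (n - int (fib (m + 1)) - i + 1) (int (fib (m + 2)) - i))" .
  have "finv (gap w 2) = of_word (block (fib (m + 4) + (fib (m + 2) - 1 - length (\<mu>1 w)))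
      (fib (m + 3) + (fib (m + 2) - 1 - length (\<mu>1 w)) + length w))"
    using n f by (intro G(5)) linarith
  also have "fib (m + 3) + (fib (m + 2) - 1 - length (\<mu>1 w)) + length w =
      fib (m + 4) + nat (n - i - 1)"
    using n i f bounds \<mu>1_length by auto
  also have "block (fib (m + 4) + (fib (m + 2) - 1 - length (\<mu>1 w))) (fib (m + 4) + nat (n - i - 1)) =
      block (fib (m + 2) - 1 - length (\<mu>1 w)) (nat (n - i - 1))"
  proof (rule block_fib_add[of "m + 1"])
    show "nat (n - i - 1) \<le> fib (m + 1 + 4) - 2" unfolding K using n i f by linarith
  qed simp
  also have "\<dots> = sub (Fw (int m + 1)) (int (fib (m + 2)) - i) (n - i - 1)"
  proof (subst sub_eq_block)
    show "occurs_at (Fw (int m + 1)) 0"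
      using occurs_at_block[of 0 "fib (m + 1 + 2)"] unfolding block_Fw K' .
    show "n - i - 1 \<le> int (length (Fw (int m + 1)))"
      using length_Fw[of "m + 1"] n i f unfolding K K' by simp
  qed (use i n f AB \<mu>1_length in \<open>auto intro!: arg_cong2[where f = block]\<close>)
  finally show "finv (gap w 2) = of_word (sub (Fw (int m + 1)) (int (fib (m + 2)) - i) (n - i - 1))" .
  show "flen (gap w 1) = int (fib (m + 3)) - n" "flen (gap w 2) = int (fib (m + 2)) - n"
    using G(3,6) n by simp_all
qed

text \<open>
  Both distances $f_k$ and $f_{k-1}$ are less than $|\omega|$.  The first overlap lies within the first
  occurrence of $s_{k-1}$; the second is moved to a factor of $F_k$ by the recurrence of the prefix
  at $f_{k+1}$.
\<close>

lemma gaps_T2_3: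
  assumes w: "regular_factor w" and sk: "sk w = sing (int m - 2)" and m: "m \<ge> 1"
    and n: "n = int (length w)" "int (fib (m + 2)) < n" "n < int (fib (m + 3))"
    and i: "0 \<le> i" "i \<le> int (fib (m + 3)) - n - 2"
    and \<mu>1: "\<mu>1 w = sub (sing (int m - 1)) (int (fib (m + 3)) - n - i) (int (fib (m + 1)))"
    and \<mu>2: "\<mu>2 w = sub (sing (int m - 1)) 1 (int (fib (m + 1)) - i - 1)"
  shows "finv (gap w 1) = of_word (sub (sing (int m - 1)) (int (fib (m + 3)) - n - i) (int (fib (m + 1)) - i - 1))"
    "flen (gap w 1) = int (fib (m + 2)) - n"
    "finv (gap w 2) = of_word (sub (Fw (int m)) (int (fib (m + 3)) - n - i - 1) (int (fib (m + 2)) - i - 2))"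
    "flen (gap w 2) = int (fib (m + 1)) - n"
proof -
  define A B where AB: "A = fib m" "B = fib (m + 1)"
  have B: "B > 0" using fib_pos[of m] AB by simp
  note f = fib_sums[of m, folded AB]
  obtain K where K': "m = K + 1" using m by (metis add.commute le_Suc_ex)
  have K: "K + 2 = m + 1" "K + 3 = m + 2" "K + 4 = m + 3" "int K - 1 = int m - 2"
    using K' by simp_all
  note s = length_sing[of m, folded AB]
  have fac: "is_factor w" using w by (simp add: regular_factor_def)
  have \<mu>1_length: "length (\<mu>1 w) = nat (n + i + 1 - int (fib (m + 2)))"
    unfolding \<mu>1 by (subst length_sub) (use i n f s AB in auto)
  have \<mu>2_length: "length (\<mu>2 w) = nat (int (fib (m + 1)) - i - 1)"
    unfolding \<mu>2 by (subst length_sub) (use i n f s AB in auto)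
  have dec: "w = \<mu>1 w @ sing (int m - 2) @ \<mu>2 w" using singular_decomposition[OF w] sk by simp
  have bounds: "length (\<mu>1 w) < fib (m + 1)" "length (\<mu>2 w) < fib (m + 1)"
    unfolding \<mu>1_length \<mu>2_length using i n f AB B by linarith+
  note G = gaps_around_sing[of w "\<mu>1 w" K "\<mu>2 w", unfolded K, OF dec fac bounds]
  have d: "int (fib (m + 1) - 1 - length (\<mu>1 w)) = int (fib (m + 3)) - n - i - 2"
    using \<mu>1_length i n f AB by linarith
  define d where "d = fib (m + 1) - 1 - length (\<mu>1 w)"
  note d = d[folded d_def]
  have "finv (gap w 1) = of_word (block (fib (m + 2) + d) (d + length w))"
    unfolding d_def using n f by (intro G(2)) linarith
  also have "block (fib (m + 2) + d) (d + length w) =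
      sub (sing (int m - 1)) (int (fib (m + 3)) - n - i) (int (fib (m + 1)) - i - 1)"
  proof (subst sub_eq_block)
    show "occurs_at (sing (int m - 1)) (fib (m + 2) - 1)"
      by (rule sing_first_occurrence)
  qed (use i n f B AB s d in \<open>auto intro!: arg_cong2[where f = block]\<close>)
  finally show "finv (gap w 1) =
    of_word (sub (sing (int m - 1)) (int (fib (m + 3)) - n - i) (int (fib (m + 1)) - i - 1))" .
  have "finv (gap w 2) = of_word (block (fib (m + 3) + d) (fib (m + 2) + d + length w))"
    unfolding d_def using n f AB by (intro G(5)) linarith
  also have "fib (m + 2) + d + length w = fib (m + 3) + nat (int (fib (m + 2)) - i - 2)"
    using n i f d by auto
  also have "block (fib (m + 3) + d) (fib (m + 3) + nat (int (fib (m + 2)) - i - 2)) =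
      block d (nat (int (fib (m + 2)) - i - 2))"
    by (rule block_fib_add[of m]) (use n i f B in auto)
  also have "\<dots> = sub (Fw (int m)) (int (fib (m + 3)) - n - i - 1) (int (fib (m + 2)) - i - 2)"
  proof (subst sub_eq_block)
    show "occurs_at (Fw (int m)) 0"
      using occurs_at_block[of 0 "fib (m + 2)"] unfolding block_Fw .
    show "int (fib (m + 2)) - i - 2 \<le> int (length (Fw (int m)))"
      using length_Fw[of m] i by simp
  qed (use i n f d in \<open>auto intro!: arg_cong2[where f = block]\<close>)
  finally show "finv (gap w 2) =
    of_word (sub (Fw (int m)) (int (fib (m + 3)) - n - i - 1) (int (fib (m + 2)) - i - 2))" .
  show "flen (gap w 1) = int (fib (m + 2)) - n" "flen (gap w 2) = int (fib (m + 1)) - n"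
    using G(3,6) n by simp_all
qed

text \<open>
  This is the smallest value of the index $i$ in type 1.2, for $k = l + 1$.  The block begins one letter
  before the offset $f_{l+2}$ at which $F_l$ recurs, with the last letter of $F_{l+2}$, which is also
  the last one of $F_l$; so it is not in the range of the periodicity of a prefix.
\<close>

lemma last_letter_rotation:
  "block (fib (l + 4) - 1) (fib (l + 4) - 1 + fib (l + 2)) = cyc (- 1) (Fw (int l))"
proof -
  let ?c = "if even l then La else Lb"
  define v where "v = butlast (Fw (int l))"
  define B where "B = length v"
  have F: "Fw (int l) = v @ [?c]" unfolding v_def by (rule Fw_last)
  then have B: "fib (l + 2) = Suc B" using length_Fw[of l] by (simp add: B_def)
  have "- 1 mod int (Suc B) = int B" by (simp add: zmod_minus1)
  then have "cyc (- 1) (Fw (int l)) = rotate B (v @ [?c])"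
    unfolding cyc_def F by (simp add: B_def)
  also have "\<dots> = ?c # v" by (simp add: B_def rotate_append)
  finally have cyc: "cyc (- 1) (Fw (int l)) = ?c # v" .
  have "sing (int (l + 1)) = ?c # butlast (Fw (int (l + 1)))"
    using sing_Fw[of "l + 1"] by simp
  moreover have "occurs_at (sing (int (l + 1))) (fib (l + 4) - 1)"
  proof -
    have "l + 2 + 2 = l + 4" "int (l + 2) - 1 = int (l + 1)" by simp_all
    then show ?thesis using sing_first_occurrence[of "l + 2"] by (simp only:)
  qed
  ultimately have c: "ltr (fib (l + 4) - 1) = ?c" by simp
  have pos: "fib (l + 4) > 0" using fib_ge3[of l] by simp
  have "block (fib (l + 4)) (fib (l + 4) + B) = block 0 B"
    using block_fib_add[of "l + 1" "l + 4" B 0] fib_sums[of "l + 1"] B by (simp add: eval_nat_numeral)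
  also have "\<dots> = v"
  proof -
    have "occurs_at (v @ [?c]) 0"
      unfolding F[symmetric] using occurs_at_block[of 0 "fib (l + 2)"] unfolding block_Fw .
    then show ?thesis using occurs_at_blockD[of v 0] by (simp add: occurs_at_append B_def)
  qed
  finally have "occurs_at (?c # v) (fib (l + 4) - 1)"
    using c pos occurs_at_block[of "fib (l + 4)" "fib (l + 4) + B"] by simp
  then have "?c # v = block (fib (l + 4) - 1) (fib (l + 4) - 1 + length (?c # v))"
    by (rule occurs_at_blockD)
  then show ?thesis unfolding cyc B by (simp add: B_def)
qed

text \<open>
  The second distance $f_k$ is $|\omega|$ itself.  The first gap has length $f_{k-1}$ and, for $i \ge f_{k-1}$,
  copies a block of a prefix with this period; the value $i = f_{k-1} - 1$ is separate.
\<close>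

lemma gaps_T1_2:
  assumes w: "regular_factor w" and sk: "sk w = sing (int m - 1)" and n: "length w = fib (m + 2)"
    and i: "int (fib (m + 1)) - 1 \<le> i" "i \<le> int (fib (m + 2)) - 1"
    and \<mu>1: "\<mu>1 w = sub (sing (int m - 2)) (i - int (fib (m + 1)) + 2) (int (fib m))"
    and \<mu>2: "\<mu>2 w = sub (sing (int m - 2)) 1 (i - int (fib (m + 1)) + 1)"
  shows "gap w 1 = of_word (cyc (i - int (fib (m + 1))) (Fw (int m - 1)))"
    "flen (gap w 1) = int (fib (m + 1))"
    "gap w 2 = of_word []"
    "flen (gap w 2) = 0"
proof -
  define A B where AB: "A = fib m" "B = fib (m + 1)"
  have B: "B > 0" using fib_pos[of m] AB by simp
  note f = fib_sums[of m, folded AB]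
  have s: "length (sing (int m - 2)) = A"
  proof (cases m)
    case 0
    then show ?thesis by (simp add: AB sing_def)
  next
    case (Suc l)
    then have "int m - 2 = int l - 1" by simp
    then show ?thesis using length_sing[of l] Suc by (simp add: AB)
  qed
  have fac: "is_factor w" using w by (simp add: regular_factor_def)
  \<comment> \<open>By this length the first offset of $\omega$, which is $f_k - 1 - |\mu_1|$, equals $i$.\<close>
  have \<mu>1_length: "length (\<mu>1 w) = nat (int (fib (m + 2)) - 1 - i)"
    unfolding \<mu>1 by (subst length_sub) (use i f s AB in auto)
  have \<mu>2_length: "length (\<mu>2 w) = nat (i - int (fib (m + 1)) + 1)"
    unfolding \<mu>2 by (subst length_sub) (use i f s AB in auto)
  have dec: "w = \<mu>1 w @ sing (int m - 1) @ \<mu>2 w" using singular_decomposition[OF w] sk by simp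
  have bounds: "length (\<mu>1 w) < fib (m + 2)" "length (\<mu>2 w) < fib (m + 2)"
    unfolding \<mu>1_length \<mu>2_length using i f AB B by linarith+
  note G = gaps_around_sing[of w "\<mu>1 w" m "\<mu>2 w", OF dec fac bounds]
  define d where "d = fib (m + 2) - 1 - length (\<mu>1 w)"
  have d: "int d = i" unfolding d_def using \<mu>1_length i f AB B by linarith
  have "gap w 1 = of_word (block (d + length w) (fib (m + 3) + d))"
    unfolding d_def using n f by (intro G(1)) linarith
  also have "block (d + length w) (fib (m + 3) + d) = cyc (i - int (fib (m + 1))) (Fw (int m - 1))"
  proof (cases "i - int (fib (m + 1)) = - 1")
    case True
    have d1: "d = B - 1" using True d AB by linarith
    show ?thesis
    proof (cases m)
      case 0
      then have AB1: "A = 0" "B = 1" using AB by simp_all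
      then have "block (d + length w) (fib (m + 3) + d) = block 1 2" using d1 n f by (simp add: numeral_2_eq_2)
      also have "\<dots> = [ltr 1]" using block_Suc[of 1 1] by (simp add: numeral_2_eq_2)
      also have "ltr 1 = Lb" using sing_first_occurrence[of 1] by (simp add: sing_0)
      finally show ?thesis using 0 True by (simp add: Fw_def cyc_def)
    next
      case (Suc l)
      have K: "int l = int m - 1" "l + 2 = m + 1" "l + 4 = m + 3" using Suc by simp_all
      have "block (d + length w) (fib (m + 3) + d) =
          block (fib (m + 3) - 1) (fib (m + 3) - 1 + fib (m + 1))"
        by (rule arg_cong2[where f = block]) (use d1 n f AB B in linarith)+
      then show ?thesis using last_letter_rotation[of l] True unfolding K by simp
    qed
  next
    case False
    then have "i - int (fib (m + 1)) = int (nat (i - int (fib (m + 1))))" using i by simp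
    then obtain a where a: "i = int (fib (m + 1)) + int a" by (metis diff_eq_eq add.commute)
    have "A > 0" using a i f AB by simp
    then obtain l where l: "m = l + 1" using AB by (cases m) auto
    have K: "l + 2 = m + 1" "l + 4 = m + 3" "int l = int m - 1" using l by simp_all
    have aA: "a < A" using a i f AB by simp
    have "block (d + length w) (fib (m + 3) + d) = block (fib (m + 3) + a) (fib (m + 3) + (a + B))"
      using d a n f AB by (intro arg_cong2[where f = block]) simp_all
    also have "\<dots> = block a (a + B)"
      by (rule block_fib_add[of m]) (use aA f B in auto)
    also have "\<dots> = rotate a (Fw (int m - 1))"
      using block_eq_rotate[of a l] aA f B unfolding K AB by simp
    finally show ?thesis using a by (simp add: cyc_int)
  qed
  finally show "gap w 1 = of_word (cyc (i - int (fib (m + 1))) (Fw (int m - 1)))" .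
  show "flen (gap w 1) = int (fib (m + 1))" "flen (gap w 2) = 0"
    using G(3,6) n f AB by simp_all
  show "gap w 2 = of_word []"
    using G(4) n f by simp
qed

text \<open>
  The first distance $f_k$ is $|\omega|$ itself.  The second and the third occurrence overlap in a
  block that has the length of a period of the prefix in which the recurrence at $f_{k+1}$ places it, and is therefore a rotation of $F_{k-2}$.
\<close>

lemma gaps_T1_3:
  assumes w: "regular_factor w" and sk: "sk w = sing (int m - 2)" and n: "length w = fib (m + 2)"
    and m: "m \<ge> 1"
    and i: "0 \<le> i" "i \<le> int (fib (m + 1)) - 2"
    and \<mu>1: "\<mu>1 w = sub (sing (int m - 1)) (i + 2) (int (fib (m + 1)))"
    and \<mu>2: "\<mu>2 w = sub (sing (int m - 1)) 1 (i + 1)"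
  shows "gap w 1 = of_word []"
    "flen (gap w 1) = 0"
    "finv (gap w 2) = of_word (cyc i (Fw (int m - 2)))"
    "flen (gap w 2) = - int (fib m)"
proof -
  define A B where AB: "A = fib m" "B = fib (m + 1)"
  have B: "B > 0" using fib_pos[of m] AB by simp
  note f = fib_sums[of m, folded AB]
  have "m \<noteq> 1" using i by auto
  then have "m = m - 2 + 2" using m by simp
  then obtain l where l: "m = l + 2" by blast
  have K: "l + 1 + 2 = m + 1" "l + 1 + 3 = m + 2" "l + 1 + 4 = m + 3" "int (l + 1) - 1 = int m - 2"
    "l + 2 = m" "l + 4 = m + 2" "int l = int m - 2"
    using l by simp_all
  have A: "A > 0" using fib_pos[of "l + 1"] l AB by simp
  note s = length_sing[of m, folded AB]
  have fac: "is_factor w" using w by (simp add: regular_factor_def)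
  have \<mu>1_length: "length (\<mu>1 w) = nat (int (fib (m + 1)) - i - 1)"
    unfolding \<mu>1 by (subst length_sub) (use i f s AB in auto)
  have \<mu>2_length: "length (\<mu>2 w) = nat (i + 1)"
    unfolding \<mu>2 by (subst length_sub) (use i f s AB in auto)
  have dec: "w = \<mu>1 w @ sing (int m - 2) @ \<mu>2 w" using singular_decomposition[OF w] sk by simp
  have bounds: "length (\<mu>1 w) < fib (m + 1)" "length (\<mu>2 w) < fib (m + 1)"
    unfolding \<mu>1_length \<mu>2_length using i f AB B by linarith+
  note G = gaps_around_sing[of w "\<mu>1 w" "l + 1" "\<mu>2 w", unfolded K(1-4), OF dec fac bounds]
  define d where "d = fib (m + 1) - 1 - length (\<mu>1 w)"
  have d: "int d = i" unfolding d_def using \<mu>1_length i f AB B by linarith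
  show "gap w 1 = of_word []"
    using G(1) n f by simp
  have "finv (gap w 2) = of_word (block (fib (m + 3) + d) (fib (m + 2) + d + length w))"
    unfolding d_def using n f A AB by (intro G(5)) linarith
  also have "fib (m + 2) + d + length w = fib (m + 3) + (d + A)" using n f by simp
  also have "block (fib (m + 3) + d) (fib (m + 3) + (d + A)) = block d (d + A)"
    by (rule block_fib_add[of m]) (use d i f B AB in auto)
  also have "\<dots> = rotate d (Fw (int m - 2))"
    using block_eq_rotate[of d l] d i f AB unfolding K(5-7) by simp
  also have "\<dots> = cyc i (Fw (int m - 2))" unfolding d[symmetric] by (simp add: cyc_int)
  finally show "finv (gap w 2) = of_word (cyc i (Fw (int m - 2)))" .
  show "flen (gap w 1) = 0" "flen (gap w 2) = - int (fib m)"
    using G(3,6) n f AB by simp_all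
qed

section \<open>The gap theorem\<close>

text \<open>
  The types quantify over their own level, which has to be that of the length.
\<close>

lemma fibl_level_unique:
  assumes "k \<ge> 0" "fibl k \<le> n" "n < fibl (k + 1)" "k' \<ge> 0" "fibl k' \<le> n" "n < fibl (k' + 1)"
  shows "k = k'"
proof -
  have mono: "fibl x \<le> fibl y" if "x \<le> y" for x y
    unfolding fibl_def using that by (simp add: fib_mono nat_mono)
  have "\<not> k < k'" using mono[of "k + 1" k'] assms by linarith
  moreover have "\<not> k' < k" using mono[of "k' + 1" k] assms by linarith
  ultimately show ?thesis by simp
qed

lemma T1_at_level:
  assumes "T1 j w" "k \<ge> 0" "fibl k \<le> int (length w)" "int (length w) < fibl (k + 1)"
  shows "regular_factor w" "sk w = sing (k - int j + 1)" "int (length w) = fibl k" "j = 3 \<longrightarrow> k \<ge> 1"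
proof -
  obtain k' where k': "k' \<ge> 0" "j = 3 \<longrightarrow> k' \<ge> 1" "int (length w) = fibl k'" "sk w = sing (k' - int j + 1)"
    using assms(1) by (auto simp: T1_def)
  have "nat (k' + 1 + 2) = Suc (nat (k' + 2))" using k'(1) by simp
  then have "fibl k' < fibl (k' + 1)"
    using fib_less_Suc[of "nat (k' + 2)"] k'(1) by (simp add: fibl_def del: of_nat_Suc)
  then have "k' = k" using fibl_level_unique[OF assms(2-4) k'(1)] k'(3) by simp
  then show "sk w = sing (k - int j + 1)" "int (length w) = fibl k" "j = 3 \<longrightarrow> k \<ge> 1"
    using k' by auto
  show "regular_factor w" using assms(1) by (simp add: T1_def)
qed

lemma T2_at_level:
  assumes "T2 j w" "k \<ge> 0" "fibl k \<le> int (length w)" "int (length w) < fibl (k + 1)"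
  shows "regular_factor w" "sk w = sing (k - int j + 1)" "fibl k < int (length w)" "j = 3 \<longrightarrow> k \<ge> 1"
proof -
  obtain k' where k': "k' \<ge> 0" "j = 3 \<longrightarrow> k' \<ge> 1" "fibl k' < int (length w)"
    "int (length w) < fibl (k' + 1)" "sk w = sing (k' - int j + 1)"
    using assms(1) by (auto simp: T2_def)
  then have "k' = k" using fibl_level_unique[OF assms(2-4) k'(1)] by simp
  then show "sk w = sing (k - int j + 1)" "fibl k < int (length w)" "j = 3 \<longrightarrow> k \<ge> 1"
    using k' by auto
  show "regular_factor w" using assms(1) by (simp add: T2_def)
qed

theorem theorem2p4:
  fixes \<omega> :: word and n k :: int
  assumes "is_factor \<omega>"
    and "\<omega> \<notin> {[], [La, Lb], [Lb, La], [La, Lb, La]}"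
    and "n = int (length \<omega>)"
    and "k \<ge> 0" and "fibl k \<le> n" and "n < fibl (k + 1)"
  shows
    "(T1 1 \<omega> \<longrightarrow>
        gap \<omega> 1 = of_word (sing (k + 1)) \<and>
        flen (gap \<omega> 1) = fibl (k + 1) \<and> fibl (k + 1) > 0 \<and>
        gap \<omega> 2 = of_word (sing (k - 1)) \<and>
        flen (gap \<omega> 2) = fibl (k - 1) \<and> fibl (k - 1) > 0)
     \<and>
     (\<forall>i. T1 2 \<omega> \<and> fibl (k - 1) - 1 \<le> i \<and> i \<le> fibl k - 1 \<and>
        \<mu>1 \<omega> = sub (sing (k - 2)) (i - fibl (k - 1) + 2) (fibl (k - 2)) \<and>
        \<mu>2 \<omega> = sub (sing (k - 2)) 1 (i - fibl (k - 1) + 1) \<longrightarrow>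
        gap \<omega> 1 = of_word (cyc (i - fibl (k - 1)) (Fw (k - 1))) \<and>
        flen (gap \<omega> 1) = fibl (k - 1) \<and> fibl (k - 1) > 0 \<and>
        gap \<omega> 2 = of_word [] \<and>
        flen (gap \<omega> 2) = 0)
     \<and>
     (\<forall>i. T1 3 \<omega> \<and> 0 \<le> i \<and> i \<le> fibl (k - 1) - 2 \<and>
        \<mu>1 \<omega> = sub (sing (k - 1)) (i + 2) (fibl (k - 1)) \<and>
        \<mu>2 \<omega> = sub (sing (k - 1)) 1 (i + 1) \<longrightarrow>
        gap \<omega> 1 = of_word [] \<and>
        flen (gap \<omega> 1) = 0 \<and>
        finv (gap \<omega> 2) = of_word (cyc i (Fw (k - 2))) \<and>
        flen (gap \<omega> 2) = - fibl (k - 2) \<and> - fibl (k - 2) < 0)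
     \<and>
     (\<forall>i. T2 1 \<omega> \<and> 0 \<le> i \<and> i \<le> n - fibl k \<and>
        \<mu>1 \<omega> = sub (sing (k - 1)) (fibl (k - 1) - i + 1) (fibl (k - 1)) \<and>
        \<mu>2 \<omega> = sub (sing (k - 1)) 1 (n - fibl k - i) \<longrightarrow>
        gap \<omega> 1 = of_word (sub (sing (k + 1)) (n - fibl k - i + 1) (fibl (k + 1) - i)) \<and>
        flen (gap \<omega> 1) = fibl (k + 2) - n \<and> fibl (k + 2) - n > 0 \<and>
        gap \<omega> 2 = of_word (sub (sing (k - 1)) (n - fibl k - i + 1) (fibl (k - 1) - i)) \<and>
        flen (gap \<omega> 2) = fibl (k + 1) - n \<and> fibl (k + 1) - n > 0)
     \<and>
     (\<forall>i. T2 2 \<omega> \<and> 0 \<le> i \<and> i \<le> n - fibl (k - 1) \<and>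
        \<mu>1 \<omega> = sub (sing k) (fibl k - i + 1) (fibl k) \<and>
        \<mu>2 \<omega> = sub (sing k) 1 (n - fibl (k - 1) - i) \<longrightarrow>
        gap \<omega> 1 = of_word (sub (sing k) (n - fibl (k - 1) - i + 1) (fibl k - i)) \<and>
        flen (gap \<omega> 1) = fibl (k + 1) - n \<and> fibl (k + 1) - n > 0 \<and>
        finv (gap \<omega> 2) = of_word (sub (Fw (k + 1)) (fibl k - i) (n - i - 1)) \<and>
        flen (gap \<omega> 2) = fibl k - n \<and> fibl k - n < 0)
     \<and>
     (\<forall>i. T2 3 \<omega> \<and> 0 \<le> i \<and> i \<le> fibl (k + 1) - n - 2 \<and>
        \<mu>1 \<omega> = sub (sing (k - 1)) (fibl (k + 1) - n - i) (fibl (k - 1)) \<and>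
        \<mu>2 \<omega> = sub (sing (k - 1)) 1 (fibl (k - 1) - i - 1) \<longrightarrow>
        finv (gap \<omega> 1) = of_word (sub (sing (k - 1)) (fibl (k + 1) - n - i) (fibl (k - 1) - i - 1)) \<and>
        flen (gap \<omega> 1) = fibl k - n \<and> fibl k - n < 0 \<and>
        finv (gap \<omega> 2) = of_word (sub (Fw k) (fibl (k + 1) - n - i - 1) (fibl k - i - 2)) \<and>
        flen (gap \<omega> 2) = fibl (k - 1) - n \<and> fibl (k - 1) - n < 0)"
proof -
  obtain m :: nat where k: "k = int m" using \<open>k \<ge> 0\<close> nonneg_int_cases by blast
  have fibl: "fibl (int m - 2) = int (fib m)" "fibl (int m - 1) = int (fib (m + 1))"
    "fibl (int m) = int (fib (m + 2))" "fibl (int m + 1) = int (fib (m + 3))"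
    "fibl (int m + 2) = int (fib (m + 4))"
    by (simp_all add: fibl_def nat_add_distrib eval_nat_numeral)
  have n: "n = int (length \<omega>)" by fact
  have level: "int m \<ge> 0" "fibl (int m) \<le> int (length \<omega>)" "int (length \<omega>) < fibl (int m + 1)"
    using assms(5,6) unfolding k n by simp_all
  have bound: "n < int (fib (m + 3))" using level n fibl by simp
  have pos: "fib (m + 1) > 0" "fib (m + 3) > 0" and f4: "fib (m + 4) = fib (m + 3) + fib (m + 2)"
    using fib_pos[of m] fib_sums[of m] by simp_all
  note L1 = T1_at_level[OF _ level] and L2 = T2_at_level[OF _ level]
  show ?thesis
    unfolding k fibl
  \<comment> \<open>The conjuncts are split off from the left, which lists the six types in reverse order.\<close>
  proof (((rule conjI[rotated])+; (intro allI impI, (elim conjE)?)), goal_cases)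
    case (1 i)
    then have m: "m \<ge> 1" using L2(4)[of 3] by simp
    have "fib (m + 1) \<le> fib (m + 2)" by (rule fib_mono) simp
    then show ?case
      using gaps_T2_3[of \<omega> m n i] L2[of 3] 1 m fibl n bound by simp
  next
    case (2 i)
    then show ?case
      using gaps_T2_2[of \<omega> m n i] L2[of 2] fibl n bound by simp
  next
    case (3 i)
    then show ?case
      using gaps_T1_1_T2_1[of \<omega> m n i] L2[of 1] fibl n bound f4 by simp
  next
    case (4 i)
    then have m: "m \<ge> 1" using L1(4)[of 3] by simp
    then have "fib m > 0" using fib_pos[of "m - 1"] by simp
    then show ?case using gaps_T1_3[of \<omega> m i] L1[of 3] 4 m fibl by simp
  next
    case (5 i)
    then show ?case using gaps_T1_2[of \<omega> m i] L1[of 2] fibl pos by simp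
  next
    case 6
    then show ?case using gaps_T1_1[of \<omega> m] L1[of 1] fibl pos by simp
  qed
qed

end
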